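(* Let $\widetilde V(\Omega)$ be the space of ultrafunctions generated by $V(\Omega)$ and, for $a\in\Omega^*$, let $\delta_a\in\widetilde V(\Omega)$ be the Delta ultrafunction concentrated in $a$. Then the set $\{\delta_a(x)\mid a\in\Omega^*\}$ generates all of $\widetilde V(\Omega)$; hence it contains a basis of $\widetilde V(\Omega)$, i.e. there is a set $\Sigma\subset\Omega^*$ such that $\{\delta_a(x)\}_{a\in\Sigma}$ is a basis of $\widetilde V(\Omega)$.
   Context: $\Lambda$-limit. Let $\mathbb U=\bigcup_{n\ge 0}\mathbb U_n$ with $\mathbb U_0=\mathbb R$, $\mathbb U_{n+1}=\mathbb U_n\cup\mathcal P(\mathbb U_n)$ (pairs are Kuratowski pairs, functions and relations are identified with their graphs). Let $\mathcal F$ be the set of finite subsets of $\mathbb U$; a net is a map defined on $\mathcal F$. Fix a superreal field $\mathbb K$ (an ordered field properly extending $\mathbb R$) and an operation assigning to each net $\varphi:\mathcal F\to\mathbb R$ a unique element $\lim_{\lambda\uparrow\mathbb U}\varphi(\lambda)\in\mathbb K$ (its $\Lambda$-limit) such that: ($\Lambda$-1) every element of $\mathbb K$ is the $\Lambda$-limit of some real net; ($\Lambda$-2) if there are $\lambda_0\in\mathcal F$, $r\in\mathbb R$ with $\varphi(\lambda)=r$ for all $\lambda\supset\lambda_0$, then the $\Lambda$-limit of $\varphi$ is $r$; ($\Lambda$-3) the $\Lambda$-limit of a sum (product) of two real nets is the sum (product) of their $\Lambda$-limits. For nets $\varphi:\mathcal F\to\mathbb U_n$, $n\ge1$, define inductively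 $\lim_{\lambda\uparrow\mathbb U}\varphi(\lambda)=\{\lim_{\lambda\uparrow\mathbb U}\psi(\lambda)\mid \psi:\mathcal F\to\mathbb U_{n-1},\ \psi(\lambda)\in\varphi(\lambda)\ \forall\lambda\}$. $\Lambda$-limits of nets of finite sets are called hyperfinite, and sums over a hyperfinite set $A=\lim A_\lambda$ are defined as $\Lambda$-limits of the finite sums over $A_\lambda$. The natural extension $E^*$ of a set $E$ is the $\Lambda$-limit of the constant net $E$; thus $\mathbb K=\mathbb R^*$. A function $f:E\to F$ extends to $f^*:E^*\to F^*$ with $f^*(\lim\varphi(\lambda))=\lim f(\varphi(\lambda))$, and a $\Lambda$-limit $u$ of functions $u_\lambda:E\to F$ is the function $u:E^*\to F^*$ with $u(\lim x_\lambda)=\lim u_\lambda(x_\lambda)$. Ultrafunctions. $\Omega$ is a set in $\mathbb R^N$, and $V(\Omega)$ is a (real or complex) vector space with $\mathcal D(\overline\Omega)\subseteq V(\Omega)\subseteq L^2(\Omega)\cap\mathcal C(\overline\Omega)$, where $\mathcal D(\overline\Omega)$ is the set of infinitely differentiable functions with compact support defined on $\overline\Omega$ and $\mathcal C(\overline\Omega)$ the set of continuous functions on $\overline\Omega$. Put $V_\lambda(\Omega)=\mathrm{Span}(V(\Omega)\cap\lambda)$ and $\widetilde V(\Omega)=\lim_{\lambda\uparrow\mathbb U}V_\lambda(\Omega)$, the space of ultrafunctions generated by $V(\Omega)$ (a vector space of hyperfinite dimension; bases are hyperfinite and linear combinations are hyperfinite sums); its elements are called ultrafunctions. $\int^*$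 is the natural extension of the Lebesgue integral $\int:L^1(\Omega)\to\mathbb C$. For $a\in\Omega^*$, the Delta ultrafunction $\delta_a$ concentrated in $a$ is the ultrafunction in $\widetilde V(\Omega)$ such that $\int^*v(x)\delta_a(x)\,dx=v(a)$ for all $v\in\widetilde V(\Omega)$. *)

theory Defs
  imports "HOL-Analysis.Analysis" "HOL-Library.FSet"
begin

section \<open>The superstructure over the reals\<close>

text \<open>
  The union of the levels \<open>U\<^sub>0 = \<real>\<close>, \<open>U\<^sub>n\<^sub>+\<^sub>1 = U\<^sub>n \<union> P(U\<^sub>n)\<close> is too large to be built inside HOL, so it
  is described, up to isomorphism, by a type \<open>'u\<close> with two maps: \<open>atom\<close> embeds the reals as atoms, and
  \<open>coll X\<close> is the element of the superstructure that stands for the set \<open>X\<close>. Only values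
  \<open>coll X\<close> with \<open>X\<close> contained in some level are meaningful.
\<close>

primrec level :: "(real \<Rightarrow> 'u) \<Rightarrow> ('u set \<Rightarrow> 'u) \<Rightarrow> nat \<Rightarrow> 'u set" where
  "level atom coll 0 = range atom"
| "level atom coll (Suc n) = level atom coll n \<union> coll ` Pow (level atom coll n)"

locale superstructure =
  fixes atom :: "real \<Rightarrow> 'u" and coll :: "'u set \<Rightarrow> 'u"
  assumes atom_inj: "inj atom"
    and coll_inj: "inj_on coll (\<Union>n. Pow (level atom coll n))"
    and atom_not_coll: "X \<subseteq> level atom coll n \<Longrightarrow> atom r \<noteq> coll X"
    and levels_exhaust: "(\<Union>n. level atom coll n) = UNIV"

definition kpair :: "('u set \<Rightarrow> 'u) \<Rightarrow> 'u \<Rightarrow> 'u \<Rightarrow> 'u" where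
  "kpair coll x y = coll {coll {x}, coll {x, y}}"

text \<open>
  A point of \<open>\<real>\<^sup>N\<close> is an \<open>N\<close>-tuple, i.e. the graph of a function on \<open>{1..N}\<close>; the index type is numbered
  by the bijection \<open>to_nat_on UNIV\<close> onto \<open>{0..<N}\<close>. A complex number is a real number or the pair of
  its real and imaginary part, so that real-valued functions have their usual graphs.
\<close>

definition point_code :: "(real \<Rightarrow> 'u) \<Rightarrow> ('u set \<Rightarrow> 'u) \<Rightarrow> real ^ 'n \<Rightarrow> 'u" where
  "point_code atom coll x =
     coll (range (\<lambda>i. kpair coll (atom (real (Suc (to_nat_on UNIV i)))) (atom (x $ i))))"

definition complex_code :: "(real \<Rightarrow> 'u) \<Rightarrow> ('u set \<Rightarrow> 'u) \<Rightarrow> complex \<Rightarrow> 'u" where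
  "complex_code atom coll z =
     (if z \<in> \<real> then atom (Re z) else kpair coll (atom (Re z)) (atom (Im z)))"

definition graph_code ::
    "(real \<Rightarrow> 'u) \<Rightarrow> ('u set \<Rightarrow> 'u) \<Rightarrow> (real ^ 'n) set \<Rightarrow> (real ^ 'n \<Rightarrow> complex) \<Rightarrow> 'u" where
  "graph_code atom coll E f =
     coll ((\<lambda>x. kpair coll (point_code atom coll x) (complex_code atom coll (f x))) ` E)"


section \<open>\<Lambda>-limits\<close>

text \<open>
  Finite subsets of the superstructure are the elements of \<open>'u fset\<close>. The sort of \<open>'k\<close> makes it an
  ordered field in which \<open>of_real\<close> embeds the reals (necessarily preserving the order).
\<close>

locale Lambda_limit = superstructure atom coll
  for atom :: "real \<Rightarrow> 'u" and coll :: "'u set \<Rightarrow> 'u" +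
  fixes Lam :: "('u fset \<Rightarrow> real) \<Rightarrow> 'k :: {linordered_field, real_algebra_1}"
  assumes proper_extension: "(\<real> :: 'k set) \<noteq> UNIV"
    and Lam_surj: "\<exists>\<phi>. Lam \<phi> = \<xi>"
    and Lam_const: "(\<And>l. l\<^sub>0 |\<subseteq>| l \<Longrightarrow> \<phi> l = r) \<Longrightarrow> Lam \<phi> = of_real r"
    and Lam_add: "Lam (\<lambda>l. \<phi> l + \<psi> l) = Lam \<phi> + Lam \<psi>"
    and Lam_mult: "Lam (\<lambda>l. \<phi> l * \<psi> l) = Lam \<phi> * Lam \<psi>"

text \<open>The natural extension of the complex numbers: the field \<open>'k\<close> with \<open>\<i>\<close> adjoined.\<close>

datatype 'k hcomplex = HComplex (hRe: 'k) (hIm: 'k)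

instantiation hcomplex :: (comm_ring_1) comm_ring_1
begin

definition "0 = HComplex 0 0"
definition "1 = HComplex 1 0"
definition "z + w = HComplex (hRe z + hRe w) (hIm z + hIm w)"
definition "- z = HComplex (- hRe z) (- hIm z)"
definition "z - w = HComplex (hRe z - hRe w) (hIm z - hIm w)"
definition "z * w = HComplex (hRe z * hRe w - hIm z * hIm w) (hRe z * hIm w + hIm z * hRe w)"

instance
  by standard
    (simp_all add: zero_hcomplex_def one_hcomplex_def plus_hcomplex_def uminus_hcomplex_def
      minus_hcomplex_def times_hcomplex_def algebra_simps)

end

definition Lam_complex ::
    "(('u fset \<Rightarrow> real) \<Rightarrow> 'k) \<Rightarrow> ('u fset \<Rightarrow> complex) \<Rightarrow> 'k hcomplex" where
  "Lam_complex Lam z = HComplex (Lam (\<lambda>l. Re (z l))) (Lam (\<lambda>l. Im (z l)))"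

definition Lam_point ::
    "(('u fset \<Rightarrow> real) \<Rightarrow> 'k) \<Rightarrow> ('u fset \<Rightarrow> real ^ 'n) \<Rightarrow> 'k ^ 'n" where
  "Lam_point Lam x = (\<chi> i. Lam (\<lambda>l. x l $ i))"

text \<open>
  The next three definitions are generic in the limit \<open>L\<close> already available for nets of
  elements.
\<close>

definition Lam_set :: "(('i \<Rightarrow> 'a) \<Rightarrow> 'b) \<Rightarrow> ('i \<Rightarrow> 'a set) \<Rightarrow> 'b set" where
  "Lam_set L A = {L \<psi> | \<psi>. \<forall>l. \<psi> l \<in> A l}"

definition nat_ext :: "(('i \<Rightarrow> 'a) \<Rightarrow> 'b) \<Rightarrow> 'a set \<Rightarrow> 'b set" where
  "nat_ext L E = Lam_set L (\<lambda>_. E)"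

text \<open>
  The limit of a net of functions on \<open>E\<close>: \<open>u (L x) = L' (u\<^sub>l (x\<^sub>l))\<close>. Functions with a given domain
  are extensional (\<open>undefined\<close> outside the domain).
\<close>

definition Lam_fun ::
    "(('i \<Rightarrow> 'a) \<Rightarrow> 'b) \<Rightarrow> (('i \<Rightarrow> 'c) \<Rightarrow> 'd) \<Rightarrow> 'a set \<Rightarrow> ('i \<Rightarrow> 'a \<Rightarrow> 'c) \<Rightarrow> 'b \<Rightarrow> 'd" where
  "Lam_fun L L' E u =
     (\<lambda>\<xi>\<in>nat_ext L E. THE \<eta>. \<exists>x. (\<forall>l. x l \<in> E) \<and> L x = \<xi> \<and> \<eta> = L' (\<lambda>l. u l (x l)))"

abbreviation Lam_cfun ::
    "(('u fset \<Rightarrow> real) \<Rightarrow> 'k) \<Rightarrow> (real ^ 'n) set \<Rightarrow>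
     ('u fset \<Rightarrow> real ^ 'n \<Rightarrow> complex) \<Rightarrow> 'k ^ 'n \<Rightarrow> 'k hcomplex" where
  "Lam_cfun Lam \<equiv> Lam_fun (Lam_point Lam) (Lam_complex Lam)"


section \<open>Function spaces on \<open>\<Omega>\<close>\<close>

text \<open>
  The set \<open>\<FF>\<close> of scalars is \<open>\<real>\<close> or \<open>UNIV\<close>, as a subset of the complex numbers; functions are
  \<open>\<FF>\<close>-valued.
\<close>

primrec Ck :: "nat \<Rightarrow> ('a::euclidean_space \<Rightarrow> 'b::real_normed_vector) \<Rightarrow> bool" where
  "Ck 0 g \<longleftrightarrow> continuous_on UNIV g"
| "Ck (Suc k) g \<longleftrightarrow> (\<forall>x. g differentiable (at x)) \<and>
     (\<forall>b\<in>Basis. Ck k (\<lambda>x. frechet_derivative g (at x) b))"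

definition test_functions :: "complex set \<Rightarrow> (real ^ 'n) set \<Rightarrow> (real ^ 'n \<Rightarrow> complex) set" where
  "test_functions \<FF> \<Omega> = {f \<in> closure \<Omega> \<rightarrow>\<^sub>E \<FF>.
     \<exists>g. (\<forall>k. Ck k g) \<and> compact (closure {x. g x \<noteq> 0}) \<and> (\<forall>x\<in>closure \<Omega>. f x = g x)}"

definition L2_continuous :: "complex set \<Rightarrow> (real ^ 'n) set \<Rightarrow> (real ^ 'n \<Rightarrow> complex) set" where
  "L2_continuous \<FF> \<Omega> = {f \<in> closure \<Omega> \<rightarrow>\<^sub>E \<FF>. continuous_on (closure \<Omega>) f \<and>
     f \<in> borel_measurable (lebesgue_on \<Omega>) \<and> integrable (lebesgue_on \<Omega>) (\<lambda>x. (norm (f x))\<^sup>2)}"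

definition L1_functions :: "(real ^ 'n) set \<Rightarrow> (real ^ 'n \<Rightarrow> complex) set" where
  "L1_functions \<Omega> = {f \<in> \<Omega> \<rightarrow>\<^sub>E UNIV. integrable (lebesgue_on \<Omega>) f}"

definition function_space :: "complex set \<Rightarrow> 'a set \<Rightarrow> ('a \<Rightarrow> complex) set \<Rightarrow> bool" where
  "function_space \<FF> E V \<longleftrightarrow> V \<subseteq> E \<rightarrow>\<^sub>E \<FF> \<and> (\<lambda>x\<in>E. 0) \<in> V \<and>
     (\<forall>f\<in>V. \<forall>g\<in>V. (\<lambda>x\<in>E. f x + g x) \<in> V) \<and> (\<forall>c\<in>\<FF>. \<forall>f\<in>V. (\<lambda>x\<in>E. c * f x) \<in> V)"

definition lincomb ::
    "'a set \<Rightarrow> ('a \<Rightarrow> complex) set \<Rightarrow> (('a \<Rightarrow> complex) \<Rightarrow> complex) \<Rightarrow> 'a \<Rightarrow> complex" where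
  "lincomb E A c = (\<lambda>x\<in>E. \<Sum>v\<in>A. c v * v x)"

definition fspan :: "complex set \<Rightarrow> 'a set \<Rightarrow> ('a \<Rightarrow> complex) set \<Rightarrow> ('a \<Rightarrow> complex) set" where
  "fspan \<FF> E B = {lincomb E A c | A c. finite A \<and> A \<subseteq> B \<and> c \<in> A \<rightarrow> \<FF>}"


section \<open>Ultrafunctions\<close>

definition V_net ::
    "(real \<Rightarrow> 'u) \<Rightarrow> ('u set \<Rightarrow> 'u) \<Rightarrow> complex set \<Rightarrow> (real ^ 'n) set \<Rightarrow>
     (real ^ 'n \<Rightarrow> complex) set \<Rightarrow> 'u fset \<Rightarrow> (real ^ 'n \<Rightarrow> complex) set" where
  "V_net atom coll \<FF> \<Omega> V l =
     fspan \<FF> (closure \<Omega>) {f \<in> V. graph_code atom coll (closure \<Omega>) f |\<in>| l}"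

definition ultrafunctions ::
    "(real \<Rightarrow> 'u) \<Rightarrow> ('u set \<Rightarrow> 'u) \<Rightarrow> (('u fset \<Rightarrow> real) \<Rightarrow> 'k) \<Rightarrow> complex set \<Rightarrow>
     (real ^ 'n) set \<Rightarrow> (real ^ 'n \<Rightarrow> complex) set \<Rightarrow> ('k ^ 'n \<Rightarrow> 'k hcomplex) set" where
  "ultrafunctions atom coll Lam \<FF> \<Omega> V =
     Lam_set (Lam_cfun Lam (closure \<Omega>)) (V_net atom coll \<FF> \<Omega> V)"

definition integral_star ::
    "(('u fset \<Rightarrow> real) \<Rightarrow> 'k) \<Rightarrow> (real ^ 'n) set \<Rightarrow> ('k ^ 'n \<Rightarrow> 'k hcomplex) \<Rightarrow> 'k hcomplex" where
  "integral_star Lam \<Omega> =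
     Lam_fun (Lam_cfun Lam \<Omega>) (Lam_complex Lam) (L1_functions \<Omega>)
       (\<lambda>_ f. integral\<^sup>L (lebesgue_on \<Omega>) f)"

definition delta_ultrafunction ::
    "(('u fset \<Rightarrow> real) \<Rightarrow> 'k::comm_ring_1) \<Rightarrow> (real ^ 'n) set \<Rightarrow> ('k ^ 'n \<Rightarrow> 'k hcomplex) set \<Rightarrow>
     'k ^ 'n \<Rightarrow> ('k ^ 'n \<Rightarrow> 'k hcomplex) \<Rightarrow> bool" where
  "delta_ultrafunction Lam \<Omega> W a d \<longleftrightarrow> d \<in> W \<and>
     (\<forall>v\<in>W. integral_star Lam \<Omega> (\<lambda>x\<in>nat_ext (Lam_point Lam) \<Omega>. v x * d x) = v a)"


section \<open>Hyperfinite linear algebra\<close>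

text \<open>
  By its definition, \<open>Lam_set L A\<close> is empty as soon as a single \<open>A l\<close> is empty, and then it says
  nothing about the other \<open>A l\<close>. A sum over a hyperfinite set is therefore only computed along nets of
  finite sets that are all nonempty or all empty; every hyperfinite set is the limit of such a net.
\<close>

definition finite_net :: "('i \<Rightarrow> 'a set) \<Rightarrow> bool" where
  "finite_net A \<longleftrightarrow> (\<forall>l. finite (A l)) \<and> ((\<forall>l. A l \<noteq> {}) \<or> (\<forall>l. A l = {}))"

text \<open>
  \<open>hyper_terms Lam \<FF> E S A c\<close>: the finite sets \<open>A\<^sub>l\<close> have a limit contained in \<open>S\<close>, and \<open>c\<close> is a net of
  coefficient functions \<open>c\<^sub>l : A\<^sub>l \<rightarrow> \<FF>\<close>; they determine the hyperfinite linear combination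
  \<open>hyper_lincomb Lam E A c\<close> of elements of \<open>S\<close>.
\<close>

definition hyper_terms ::
    "(('u fset \<Rightarrow> real) \<Rightarrow> 'k) \<Rightarrow> complex set \<Rightarrow> (real ^ 'n) set \<Rightarrow> ('k ^ 'n \<Rightarrow> 'k hcomplex) set \<Rightarrow>
     ('u fset \<Rightarrow> (real ^ 'n \<Rightarrow> complex) set) \<Rightarrow>
     ('u fset \<Rightarrow> (real ^ 'n \<Rightarrow> complex) \<Rightarrow> complex) \<Rightarrow> bool" where
  "hyper_terms Lam \<FF> E S A c \<longleftrightarrow>
     finite_net A \<and> (\<forall>l. A l \<subseteq> E \<rightarrow>\<^sub>E \<FF>) \<and> Lam_set (Lam_cfun Lam E) A \<subseteq> S \<and> (\<forall>l. c l \<in> A l \<rightarrow> \<FF>)"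

definition hyper_lincomb ::
    "(('u fset \<Rightarrow> real) \<Rightarrow> 'k) \<Rightarrow> (real ^ 'n) set \<Rightarrow> ('u fset \<Rightarrow> (real ^ 'n \<Rightarrow> complex) set) \<Rightarrow>
     ('u fset \<Rightarrow> (real ^ 'n \<Rightarrow> complex) \<Rightarrow> complex) \<Rightarrow> 'k ^ 'n \<Rightarrow> 'k hcomplex" where
  "hyper_lincomb Lam E A c = Lam_cfun Lam E (\<lambda>l. lincomb E (A l) (c l))"

definition hyper_span ::
    "(('u fset \<Rightarrow> real) \<Rightarrow> 'k) \<Rightarrow> complex set \<Rightarrow> (real ^ 'n) set \<Rightarrow>
     ('k ^ 'n \<Rightarrow> 'k hcomplex) set \<Rightarrow> ('k ^ 'n \<Rightarrow> 'k hcomplex) set" where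
  "hyper_span Lam \<FF> E S = {hyper_lincomb Lam E A c | A c. hyper_terms Lam \<FF> E S A c}"

definition hyper_independent ::
    "(('u fset \<Rightarrow> real) \<Rightarrow> 'k::comm_ring_1) \<Rightarrow> complex set \<Rightarrow> (real ^ 'n) set \<Rightarrow>
     ('k ^ 'n \<Rightarrow> 'k hcomplex) set \<Rightarrow> bool" where
  "hyper_independent Lam \<FF> E S \<longleftrightarrow>
     (\<forall>A c. hyper_terms Lam \<FF> E S A c \<and>
        hyper_lincomb Lam E A c = (\<lambda>\<xi>\<in>nat_ext (Lam_point Lam) E. 0) \<longrightarrow>
        (\<forall>v. (\<forall>l. v l \<in> A l) \<longrightarrow> Lam_complex Lam (\<lambda>l. c l (v l)) = 0))"

definition hyper_basis ::
    "(('u fset \<Rightarrow> real) \<Rightarrow> 'k::comm_ring_1) \<Rightarrow> complex set \<Rightarrow> (real ^ 'n) set \<Rightarrow>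
     ('k ^ 'n \<Rightarrow> 'k hcomplex) set \<Rightarrow> ('k ^ 'n \<Rightarrow> 'k hcomplex) set \<Rightarrow> bool" where
  "hyper_basis Lam \<FF> E W B \<longleftrightarrow>
     (\<exists>A. finite_net A \<and> (\<forall>l. A l \<subseteq> E \<rightarrow>\<^sub>E \<FF>) \<and> B = Lam_set (Lam_cfun Lam E) A) \<and>
     B \<subseteq> W \<and> hyper_independent Lam \<FF> E B \<and> hyper_span Lam \<FF> E B = W"

end

theory Submission
  imports Defs
begin

text \<open>
  A \<Lambda>-limit of real nets is a surjective ring homomorphism onto a field, so it identifies two nets
  exactly when they agree on a set of indices that belongs to an ultrafilter, here called \<open>large\<close>
  (\<open>Lam_eq_iff\<close>). Hence limits of points and of functions are equal iff the nets agree on a large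
  set of indices, and a property that holds along every net chosen from sets \<open>X\<^sub>l\<close> holds, for a large
  set of \<open>l\<close>, on all of \<open>X\<^sub>l\<close> (\<open>eventually_ball_net\<close>: otherwise choose a net of counterexamples). The
  theorem thereby becomes a statement about a single space \<open>V\<^sub>l\<close>, which is finite-dimensional because
  distinct functions have distinct codes and \<open>l\<close> is finite.

  At a single index the pairing \<open>\<integral> f g\<close> replaces an inner product; it is bilinear, also over the complex
  numbers. Existence of the delta ultrafunctions means that, for a large set of \<open>l\<close>, every point \<open>a\<close>
  of \<open>\<Omega>\<close> has some \<open>d\<^sub>a \<in> V\<^sub>l\<close> with \<open>\<integral> v d\<^sub>a = v(a)\<close> for all \<open>v \<in> V\<^sub>l\<close>
  (\<open>eventually_has_deltas\<close>). Then the pairing is nondegenerate on \<open>V\<^sub>l\<close>: a function that is orthogonal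
  to all \<open>d\<^sub>a\<close> vanishes on \<open>\<Omega>\<close>, hence by continuity on its closure. In particular \<open>d\<^sub>a\<close> is unique.
  As \<open>V\<^sub>l\<close> is finite-dimensional, it has interpolation points \<open>P \<subseteq> \<Omega>\<close> with Lagrange functions \<open>e\<^sub>p\<close>
  (\<open>lagrange_functions\<close>). Since \<open>\<integral> e\<^sub>q d\<^sub>p = e\<^sub>q(p)\<close>, the families \<open>d\<^sub>p\<close> and \<open>e\<^sub>p\<close> are dual to each other,
  so the \<open>d\<^sub>p\<close> are independent, and \<open>w = \<Sum>\<^sub>p (\<integral> w e\<^sub>p) d\<^sub>p\<close> for all \<open>w \<in> V\<^sub>l\<close>, because the difference of the
  two sides is orthogonal to every \<open>e\<^sub>q\<close> (\<open>delta_basis\<close>).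

  The set \<open>\<Sigma>\<close> is the limit of these point sets \<open>P\<^sub>l\<close>. By uniqueness, \<open>\<delta>\<close> at the limit of points
  \<open>x\<^sub>l\<close> is the limit of the \<open>d\<close> at \<open>x\<^sub>l\<close> (\<open>delta_net\<close>), so \<open>\<delta> ` \<Sigma>\<close> is the limit of the bases of the
  \<open>V\<^sub>l\<close> and therefore a hyperfinite basis (\<open>hyper_basis_Lam_set\<close>).
\<close>

section \<open>Codes of functions in the superstructure\<close>

context superstructure
begin

lemma level_mono: "m \<le> n \<Longrightarrow> level atom coll m \<subseteq> level atom coll n"
  by (induction rule: dec_induct) auto

lemma atom_in_level: "atom r \<in> level atom coll n"
  using level_mono[of 0 n] by auto

lemma coll_in_level: "X \<subseteq> level atom coll n \<Longrightarrow> coll X \<in> level atom coll (Suc n)"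
  by auto

lemma coll_eqD:
  assumes "coll X = coll Y" "X \<subseteq> level atom coll n" "Y \<subseteq> level atom coll n"
  shows "X = Y"
  using inj_onD[OF coll_inj assms(1)] assms(2,3) by blast

lemma kpair_in_level:
  assumes "x \<in> level atom coll n" "y \<in> level atom coll n"
  shows "kpair coll x y \<in> level atom coll (n + 2)"
  using assms unfolding kpair_def by (auto intro!: coll_in_level)

text \<open>
  The usual argument for Kuratowski pairs; a common level makes \<open>coll\<close> injective on every set that
  occurs in it.
\<close>

lemma kpair_eqD:
  assumes eq: "kpair coll x y = kpair coll x' y'"
    and lev: "{x, y, x', y'} \<subseteq> level atom coll n"
  shows "x = x' \<and> y = y'"
proof -
  have "{coll {x}, coll {x, y}} = {coll {x'}, coll {x', y'}}"
    by (rule coll_eqD[OF eq[unfolded kpair_def], of "Suc n"]) (use lev in auto)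
  moreover have inj: "coll X = coll Y \<longleftrightarrow> X = Y"
    if "X \<subseteq> {x, y, x', y'}" "Y \<subseteq> {x, y, x', y'}" for X Y
    using coll_eqD[of X Y n] that lev by blast
  ultimately show ?thesis
    by (auto simp: doubleton_eq_iff inj)
qed

lemma kpair_atoms_in_level: "kpair coll (atom r) (atom s) \<in> level atom coll 2"
  using kpair_in_level[of "atom r" 0 "atom s"] by (simp del: level.simps(2) add: numeral_2_eq_2)

lemma point_code_in_level: "point_code atom coll x \<in> level atom coll 3"
proof -
  have "range (\<lambda>i. kpair coll (atom (real (Suc (to_nat_on UNIV i)))) (atom (x $ i)))
      \<subseteq> level atom coll 2"
    using kpair_atoms_in_level by auto
  then show ?thesis
    unfolding point_code_def using coll_in_level[of _ 2] by (simp add: numeral_3_eq_3 numeral_2_eq_2)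
qed

lemma complex_code_in_level: "complex_code atom coll z \<in> level atom coll 3"
proof -
  have "complex_code atom coll z \<in> level atom coll 2"
    unfolding complex_code_def using kpair_atoms_in_level atom_in_level by auto
  then show ?thesis using level_mono[of 2 3] by auto
qed

lemma point_code_inj:
  fixes x y :: "real ^ 'n"
  assumes "point_code atom coll x = point_code atom coll y"
  shows "x = y"
proof -
  let ?p = "\<lambda>x i. kpair coll (atom (real (Suc (to_nat_on UNIV i)))) (atom ((x :: real ^ 'n) $ i))"
  have "range (?p x) = range (?p y)"
    by (rule coll_eqD[OF assms[unfolded point_code_def], of 2])
      (use kpair_atoms_in_level in auto)
  show "x = y"
  proof (rule vec_eq_iff[THEN iffD2], rule allI)
    fix i
    obtain j where "?p x i = ?p y j"
      using \<open>range (?p x) = range (?p y)\<close> by blast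
    then have "atom (real (Suc (to_nat_on UNIV i))) = atom (real (Suc (to_nat_on UNIV j))) \<and>
        atom (x $ i) = atom (y $ j)"
      by (rule kpair_eqD[where n = 0]) auto
    then have "to_nat_on UNIV i = to_nat_on UNIV j" "x $ i = y $ j"
      using atom_inj by (auto simp: inj_eq)
    moreover have "inj (to_nat_on (UNIV :: 'n set))"
      by (simp add: countable_finite inj_on_to_nat_on)
    ultimately show "x $ i = y $ i" by (auto dest: injD)
  qed
qed

text \<open>
  Real numbers are coded by atoms and the other complex numbers by pairs, so the two cases cannot
  clash.
\<close>

lemma complex_code_inj:
  assumes "complex_code atom coll z = complex_code atom coll w"
  shows "z = w"
proof -
  have atom_neq: "atom r \<noteq> kpair coll (atom s) (atom t)" for r s t
    unfolding kpair_def by (rule atom_not_coll[where n = 1]) (auto intro!: coll_in_level)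
  show ?thesis
  proof (cases "z \<in> \<real>")
    case True
    then show ?thesis
      using assms atom_inj atom_neq
      by (auto simp: complex_code_def complex_eq_iff complex_is_Real_iff inj_eq split: if_splits)
  next
    case False
    then have "kpair coll (atom (Re z)) (atom (Im z)) = kpair coll (atom (Re w)) (atom (Im w))"
      using assms atom_neq[symmetric] by (auto simp: complex_code_def split: if_splits)
    then have "atom (Re z) = atom (Re w) \<and> atom (Im z) = atom (Im w)"
      by (rule kpair_eqD[where n = 0]) auto
    then show ?thesis using atom_inj by (simp add: complex_eq_iff inj_eq)
  qed
qed

lemma graph_code_inj:
  fixes f g :: "real ^ 'n \<Rightarrow> complex"
  assumes eq: "graph_code atom coll E f = graph_code atom coll E g"
    and ext: "f \<in> extensional E" "g \<in> extensional E"
  shows "f = g"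
proof (rule extensionalityI[OF ext])
  fix x assume "x \<in> E"
  let ?p = "\<lambda>f x. kpair coll (point_code atom coll (x :: real ^ 'n)) (complex_code atom coll (f x))"
  have "?p h ` E \<subseteq> level atom coll 5" for h
    using kpair_in_level[of _ 3] point_code_in_level complex_code_in_level by auto
  then have "?p f ` E = ?p g ` E"
    using coll_eqD[OF eq[unfolded graph_code_def]] by blast
  then obtain y where "?p f x = ?p g y"
    using \<open>x \<in> E\<close> by blast
  then have "point_code atom coll x = point_code atom coll y \<and>
      complex_code atom coll (f x) = complex_code atom coll (g y)"
    by (rule kpair_eqD[where n = 3]) (use point_code_in_level complex_code_in_level in auto)
  then show "f x = g x"
    using point_code_inj complex_code_inj by blast
qed

text \<open>
  This is what makes the spaces \<open>V\<^sub>l\<close> finite-dimensional.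
\<close>

lemma finite_coded_functions:
  assumes "V \<subseteq> extensional E"
  shows "finite {f \<in> V. graph_code atom coll E f |\<in>| l}"
proof -
  have "inj_on (graph_code atom coll E) V"
    using graph_code_inj assms by (blast intro: inj_onI)
  then have "finite (graph_code atom coll E -` fset l \<inter> V)"
    by (simp add: finite_vimage_IntI)
  then show ?thesis
    by (rule rev_finite_subset) auto
qed

end

section \<open>The ultrafilter of a \<Lambda>-limit\<close>

context Lambda_limit
begin

text \<open>
  The ultrafilter on the finite subsets of the superstructure that corresponds to the kernel of the
  ring homomorphism \<open>Lam\<close>.
\<close>

definition large :: "'u fset filter" where
  "large = Abs_filter (\<lambda>P. Lam (\<lambda>l. of_bool (P l)) = 1)"

lemma Lam_constant: "Lam (\<lambda>_. r) = of_real r"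
  by (rule Lam_const) simp

lemma Lam_diff: "Lam (\<lambda>l. \<phi> l - \<psi> l) = Lam \<phi> - Lam \<psi>"
  using Lam_add[of "\<lambda>l. \<phi> l - \<psi> l" \<psi>] by (simp add: algebra_simps)

lemma eventually_large: "eventually P large \<longleftrightarrow> Lam (\<lambda>l. of_bool (P l)) = 1"
proof -
  have "is_filter (\<lambda>P. Lam (\<lambda>l. of_bool (P l)) = 1)"
  proof
    show "Lam (\<lambda>l. of_bool True) = 1" using Lam_constant[of 1] by simp
  next
    fix P Q assume "Lam (\<lambda>l. of_bool (P l)) = 1" "Lam (\<lambda>l. of_bool (Q l)) = 1"
    then show "Lam (\<lambda>l. of_bool (P l \<and> Q l)) = 1"
      using Lam_mult[of "\<lambda>l. of_bool (P l)" "\<lambda>l. of_bool (Q l)"] by (simp add: of_bool_conj)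
  next
    fix P Q :: "'u fset \<Rightarrow> bool"
    assume "\<forall>l. P l \<longrightarrow> Q l" and 1: "Lam (\<lambda>l. of_bool (P l)) = 1"
    then have "(\<lambda>l. of_bool (P l) * of_bool (Q l)) = (\<lambda>l. of_bool (P l) :: real)" by auto
    then show "Lam (\<lambda>l. of_bool (Q l)) = 1"
      using Lam_mult[of "\<lambda>l. of_bool (P l)" "\<lambda>l. of_bool (Q l)"] 1 by simp
  qed
  then show ?thesis
    unfolding large_def by (simp add: eventually_Abs_filter)
qed

lemma Lam_of_bool_not: "Lam (\<lambda>l. of_bool (\<not> P l)) = 1 - Lam (\<lambda>l. of_bool (P l))"
  using Lam_diff[of "\<lambda>_. 1" "\<lambda>l. of_bool (P l)"] Lam_constant[of 1] by (simp add: of_bool_not_iff)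

text \<open>
  An indicator function is idempotent, and a field has only two idempotents.
\<close>

lemma large_ultra: "eventually P large \<or> eventually (\<lambda>l. \<not> P l) large"
proof -
  let ?e = "Lam (\<lambda>l. of_bool (P l))"
  have "?e * ?e = ?e"
    using Lam_mult[of "\<lambda>l. of_bool (P l)" "\<lambda>l. of_bool (P l)"] by (simp flip: of_bool_conj)
  then have "?e = 0 \<or> ?e = 1" by simp
  then show ?thesis
    using Lam_of_bool_not[of P] by (auto simp: eventually_large)
qed

text \<open>
  Both directions multiply the difference of the two nets by a net that turns it into an indicator
  function: its pointwise inverse in one case, the indicator of its zero set in the other.
\<close>

lemma Lam_eq_iff: "Lam \<phi> = Lam \<psi> \<longleftrightarrow> (\<forall>\<^sub>F l in large. \<phi> l = \<psi> l)"
proof -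
  let ?\<chi> = "\<lambda>l. \<phi> l - \<psi> l"
  let ?e = "\<lambda>l. of_bool (\<phi> l = \<psi> l) :: real"
  have "Lam ?\<chi> = 0 \<longleftrightarrow> Lam ?e = 1"
  proof
    assume 0: "Lam ?\<chi> = 0"
    have "(\<lambda>l. ?\<chi> l * inverse (?\<chi> l)) = (\<lambda>l. of_bool (\<not> \<phi> l = \<psi> l))"
      by (auto simp: fun_eq_iff)
    then have "Lam (\<lambda>l. of_bool (\<not> \<phi> l = \<psi> l)) = 0"
      using Lam_mult[of ?\<chi> "\<lambda>l. inverse (?\<chi> l)"] 0 by simp
    then show "Lam ?e = 1" by (simp add: Lam_of_bool_not)
  next
    assume "Lam ?e = 1"
    moreover have "(\<lambda>l. ?\<chi> l * ?e l) = (\<lambda>_. 0)" by auto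
    ultimately show "Lam ?\<chi> = 0"
      using Lam_mult[of ?\<chi> ?e] Lam_constant[of 0] by simp
  qed
  then show ?thesis
    by (simp add: Lam_diff eventually_large)
qed

text \<open>
  The transfer principle used throughout: choose \<open>x\<^sub>l\<close> to be a counterexample in \<open>X\<^sub>l\<close> whenever there is
  one. Then \<open>Q\<close> can hold at \<open>x\<^sub>l\<close> only if \<open>X\<^sub>l\<close> contains no counterexample.
\<close>

lemma eventually_ball_net:
  assumes ne: "\<And>l. X l \<noteq> {}"
    and nets: "\<And>x. (\<And>l. x l \<in> X l) \<Longrightarrow> \<forall>\<^sub>F l in F. Q l (x l)"
  shows "\<forall>\<^sub>F l in F. \<forall>y\<in>X l. Q l y"
proof -
  have "\<forall>l. \<exists>y. y \<in> X l \<and> (Q l y \<longrightarrow> (\<forall>y\<in>X l. Q l y))"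
    using ne by blast
  then obtain x where x: "\<And>l. x l \<in> X l" "\<And>l. Q l (x l) \<longrightarrow> (\<forall>y\<in>X l. Q l y)"
    by metis
  from nets[OF x(1)] show ?thesis
    by (rule eventually_mono) (use x(2) in blast)
qed

lemma Lam_complex_eq_iff: "Lam_complex Lam z = Lam_complex Lam w \<longleftrightarrow> (\<forall>\<^sub>F l in large. z l = w l)"
  by (simp add: Lam_complex_def Lam_eq_iff complex_eq_iff eventually_conj_iff)

lemma Lam_point_eq_iff: "Lam_point Lam x = Lam_point Lam y \<longleftrightarrow> (\<forall>\<^sub>F l in large. x l = y l)"
  by (auto simp: Lam_point_def Lam_eq_iff vec_eq_iff intro: eventually_all_finite elim: eventually_mono)

lemma Lam_complex_mult:
  "Lam_complex Lam (\<lambda>l. z l * w l) = Lam_complex Lam z * Lam_complex Lam w"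
  by (simp add: Lam_complex_def times_hcomplex_def Lam_add Lam_diff Lam_mult)

lemma Lam_complex_zero: "Lam_complex Lam (\<lambda>_. 0) = 0"
  using Lam_constant[of 0] by (simp add: Lam_complex_def zero_hcomplex_def)

text \<open>
  The limit of a net of functions is defined by a description that ranges over all nets of arguments
  with the given limit; the second premise says that their choice is irrelevant.
\<close>

lemma Lam_fun_apply:
  assumes "\<And>l. x l \<in> E"
    and "\<And>y. (\<And>l. y l \<in> E) \<Longrightarrow> L y = L x \<Longrightarrow> L' (\<lambda>l. u l (y l)) = L' (\<lambda>l. u l (x l))"
  shows "Lam_fun L L' E u (L x) = L' (\<lambda>l. u l (x l))"
proof -
  have "L x \<in> nat_ext L E"
    using assms(1) unfolding nat_ext_def Lam_set_def by blast
  then show ?thesis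
    unfolding Lam_fun_def restrict_apply'
    by (simp, intro the_equality) (use assms in blast)+
qed

lemma Lam_cfun_apply:
  assumes "\<And>l. x l \<in> E"
  shows "Lam_cfun Lam E u (Lam_point Lam x) = Lam_complex Lam (\<lambda>l. u l (x l))"
proof (rule Lam_fun_apply[OF assms])
  fix y assume "Lam_point Lam y = Lam_point Lam x"
  then show "Lam_complex Lam (\<lambda>l. u l (y l)) = Lam_complex Lam (\<lambda>l. u l (x l))"
    unfolding Lam_point_eq_iff Lam_complex_eq_iff by (rule eventually_mono) simp
qed

lemma nat_ext_pointE:
  assumes "a \<in> nat_ext (Lam_point Lam) E"
  obtains x where "\<forall>l. x l \<in> E" "a = Lam_point Lam x"
  using assms unfolding nat_ext_def Lam_set_def by blast

lemma Lam_cfun_cong: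
  assumes "\<forall>\<^sub>F l in large. u l = v l"
  shows "Lam_cfun Lam E u = Lam_cfun Lam E v"
proof (rule extensionalityI[where A = "nat_ext (Lam_point Lam) E"])
  fix a assume "a \<in> nat_ext (Lam_point Lam) E"
  then obtain x where "\<forall>l. x l \<in> E" "a = Lam_point Lam x"
    by (rule nat_ext_pointE)
  then show "Lam_cfun Lam E u a = Lam_cfun Lam E v a"
    using assms by (auto simp: Lam_cfun_apply Lam_complex_eq_iff elim: eventually_mono)
qed (auto simp: Lam_fun_def)

lemma Lam_cfun_eq_iff:
  assumes "\<And>l. u l \<in> extensional E" "\<And>l. v l \<in> extensional E"
  shows "Lam_cfun Lam E u = Lam_cfun Lam E v \<longleftrightarrow> (\<forall>\<^sub>F l in large. u l = v l)"
proof
  assume eq: "Lam_cfun Lam E u = Lam_cfun Lam E v"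
  show "\<forall>\<^sub>F l in large. u l = v l"
  proof (cases "E = {}")
    case False
    have "\<forall>\<^sub>F l in large. \<forall>x\<in>E. u l x = v l x"
    proof (rule eventually_ball_net)
      fix x :: "'u fset \<Rightarrow> _" assume "\<And>l. x l \<in> E"
      then have "Lam_complex Lam (\<lambda>l. u l (x l)) = Lam_complex Lam (\<lambda>l. v l (x l))"
        using eq Lam_cfun_apply[of x E u] Lam_cfun_apply[of x E v] by simp
      then show "\<forall>\<^sub>F l in large. u l (x l) = v l (x l)"
        by (simp add: Lam_complex_eq_iff)
    qed (use False in auto)
    then show ?thesis
      by (rule eventually_mono) (use assms in \<open>blast intro: extensionalityI\<close>)
  qed (use assms in auto)
qed (rule Lam_cfun_cong)

lemma Lam_cfun_zero: "Lam_cfun Lam E (\<lambda>_. \<lambda>x\<in>E. 0) = (\<lambda>\<xi>\<in>nat_ext (Lam_point Lam) E. 0)"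
proof (rule extensionalityI[where A = "nat_ext (Lam_point Lam) E"])
  fix a assume a: "a \<in> nat_ext (Lam_point Lam) E"
  then obtain x where "\<forall>l. x l \<in> E" "a = Lam_point Lam x"
    by (rule nat_ext_pointE)
  then show "Lam_cfun Lam E (\<lambda>_. \<lambda>x\<in>E. 0) a = (\<lambda>\<xi>\<in>nat_ext (Lam_point Lam) E. 0) a"
    using a by (auto simp: Lam_cfun_apply Lam_complex_zero)
qed (auto simp: Lam_fun_def)

text \<open>
  Nonemptiness of all \<open>A\<^sub>l\<close> is essential: the limit of a net of sets is empty as soon as one of them
  is.
\<close>

lemma Lam_set_cfun_subsetD:
  assumes sub: "Lam_set (Lam_cfun Lam E) A \<subseteq> Lam_set (Lam_cfun Lam E) B"
    and ne: "\<And>l. A l \<noteq> {}"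
    and ext: "\<And>l. A l \<subseteq> extensional E" "\<And>l. B l \<subseteq> extensional E"
  shows "\<forall>\<^sub>F l in large. A l \<subseteq> B l"
proof -
  have "\<forall>\<^sub>F l in large. \<forall>u\<in>A l. u \<in> B l"
  proof (rule eventually_ball_net[OF ne])
    fix u assume u: "\<And>l. u l \<in> A l"
    then obtain v where v: "\<And>l. v l \<in> B l" "Lam_cfun Lam E u = Lam_cfun Lam E v"
      using sub unfolding Lam_set_def by blast
    have "\<forall>\<^sub>F l in large. u l = v l"
      using u v ext by (subst Lam_cfun_eq_iff[symmetric]) blast+
    then show "\<forall>\<^sub>F l in large. u l \<in> B l"
      by (rule eventually_mono) (use v in auto)
  qed
  then show ?thesis by (simp add: subset_eq)
qed

end

section \<open>Finite-dimensional function spaces with delta functions\<close>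

locale scalars =
  fixes \<FF> :: "complex set"
  assumes real_or_complex: "\<FF> = \<real> \<or> \<FF> = UNIV"
begin

lemma scalar_closed:
  "0 \<in> \<FF>" "1 \<in> \<FF>"
  "a \<in> \<FF> \<Longrightarrow> b \<in> \<FF> \<Longrightarrow> a + b \<in> \<FF>"
  "a \<in> \<FF> \<Longrightarrow> - a \<in> \<FF>"
  "a \<in> \<FF> \<Longrightarrow> b \<in> \<FF> \<Longrightarrow> a * b \<in> \<FF>"
  "a \<in> \<FF> \<Longrightarrow> inverse a \<in> \<FF>"
  using real_or_complex by auto

lemma function_space_add:
  "function_space \<FF> E T \<Longrightarrow> f \<in> T \<Longrightarrow> g \<in> T \<Longrightarrow> (\<lambda>x\<in>E. f x + g x) \<in> T"
  by (simp add: function_space_def)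

lemma function_space_scale:
  "function_space \<FF> E T \<Longrightarrow> c \<in> \<FF> \<Longrightarrow> f \<in> T \<Longrightarrow> (\<lambda>x\<in>E. c * f x) \<in> T"
  by (simp add: function_space_def)

lemma function_space_sum:
  assumes T: "function_space \<FF> E T" and "\<And>p. p \<in> P \<Longrightarrow> c p \<in> \<FF> \<and> e p \<in> T"
  shows "(\<lambda>x\<in>E. \<Sum>p\<in>P. c p * e p x) \<in> T"
  using assms(2)
proof (induction P rule: infinite_finite_induct)
  case (insert q P)
  let ?f = "\<lambda>x\<in>E. c q * e q x" and ?g = "\<lambda>x\<in>E. \<Sum>p\<in>P. c p * e p x"
  have "?f \<in> T" "?g \<in> T"
    using insert function_space_scale[OF T] by blast+
  then have "(\<lambda>x\<in>E. ?f x + ?g x) \<in> T"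
    by (rule function_space_add[OF T])
  also have "(\<lambda>x\<in>E. ?f x + ?g x) = (\<lambda>x\<in>E. \<Sum>p\<in>insert q P. c p * e p x)"
    using insert by (auto simp: restrict_def)
  finally show ?case .
qed (use T in \<open>simp_all add: function_space_def\<close>)

lemma function_space_diff:
  assumes T: "function_space \<FF> E T" and "f \<in> T" "g \<in> T"
  shows "(\<lambda>x\<in>E. f x - g x) \<in> T"
proof -
  let ?h = "\<lambda>x\<in>E. - 1 * g x"
  have "?h \<in> T"
    using function_space_scale[OF T _ \<open>g \<in> T\<close>, of "- 1"] scalar_closed by blast
  then have "(\<lambda>x\<in>E. f x + ?h x) \<in> T"
    by (rule function_space_add[OF T \<open>f \<in> T\<close>])
  also have "(\<lambda>x\<in>E. f x + ?h x) = (\<lambda>x\<in>E. f x - g x)"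
    by (auto simp: restrict_def)
  finally show ?thesis .
qed

lemma function_space_value: "function_space \<FF> E T \<Longrightarrow> f \<in> T \<Longrightarrow> x \<in> E \<Longrightarrow> f x \<in> \<FF>"
  by (auto simp: function_space_def)

lemma function_space_extensional: "function_space \<FF> E T \<Longrightarrow> T \<subseteq> extensional E"
  by (auto simp: function_space_def PiE_def)

lemma lincomb_in_function_space:
  assumes "function_space \<FF> E T" "A \<subseteq> T" "c \<in> A \<rightarrow> \<FF>"
  shows "lincomb E A c \<in> T"
  unfolding lincomb_def by (rule function_space_sum[OF assms(1)]) (use assms(2,3) in auto)

lemma fspan_subset:
  assumes "function_space \<FF> E T" "S \<subseteq> T"
  shows "fspan \<FF> E S \<subseteq> T"
  unfolding fspan_def using lincomb_in_function_space[OF assms(1)] assms(2) by blast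

lemma function_space_fspan:
  assumes S: "S \<subseteq> E \<rightarrow>\<^sub>E \<FF>"
  shows "function_space \<FF> E (fspan \<FF> E S)"
  unfolding function_space_def
proof (intro conjI ballI)
  have "function_space \<FF> E (E \<rightarrow>\<^sub>E \<FF>)"
    by (simp add: function_space_def PiE_iff scalar_closed)
  then show "fspan \<FF> E S \<subseteq> E \<rightarrow>\<^sub>E \<FF>"
    using fspan_subset S by blast
  show "(\<lambda>x\<in>E. 0) \<in> fspan \<FF> E S"
    unfolding fspan_def lincomb_def by (intro CollectI exI[of _ "{}"]) auto
next
  fix f g assume "f \<in> fspan \<FF> E S" "g \<in> fspan \<FF> E S"
  then obtain A c B d where
      A: "finite A" "A \<subseteq> S" "c \<in> A \<rightarrow> \<FF>" "f = lincomb E A c" and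
      B: "finite B" "B \<subseteq> S" "d \<in> B \<rightarrow> \<FF>" "g = lincomb E B d"
    unfolding fspan_def by blast
  let ?c = "\<lambda>v. if v \<in> A then c v else 0" and ?d = "\<lambda>v. if v \<in> B then d v else 0"
  have "(\<Sum>v\<in>A. c v * v x) = (\<Sum>v\<in>A \<union> B. ?c v * v x)"
       "(\<Sum>v\<in>B. d v * v x) = (\<Sum>v\<in>A \<union> B. ?d v * v x)" for x
    using A(1) B(1) by (auto intro!: sum.mono_neutral_cong_left)
  then have "(\<lambda>x\<in>E. f x + g x) = lincomb E (A \<union> B) (\<lambda>v. ?c v + ?d v)"
    unfolding A(4) B(4) lincomb_def by (auto simp: restrict_def distrib_right sum.distrib)
  moreover have "(\<lambda>v. ?c v + ?d v) \<in> A \<union> B \<rightarrow> \<FF>"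
    using Pi_mem[OF A(3)] Pi_mem[OF B(3)] by (auto simp: scalar_closed)
  ultimately show "(\<lambda>x\<in>E. f x + g x) \<in> fspan \<FF> E S"
    using A(1,2) B(1,2) unfolding fspan_def
    by (intro CollectI exI[of _ "A \<union> B"] exI[of _ "\<lambda>v. ?c v + ?d v"]) simp
next
  fix a f assume "a \<in> \<FF>" "f \<in> fspan \<FF> E S"
  then obtain A c where A: "finite A" "A \<subseteq> S" "c \<in> A \<rightarrow> \<FF>" "f = lincomb E A c"
    unfolding fspan_def by blast
  have "(\<lambda>x\<in>E. a * f x) = lincomb E A (\<lambda>v. a * c v)"
    unfolding A(4) lincomb_def by (auto simp: restrict_def sum_distrib_left mult.assoc)
  moreover have "(\<lambda>v. a * c v) \<in> A \<rightarrow> \<FF>"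
    using Pi_mem[OF A(3)] \<open>a \<in> \<FF>\<close> by (auto simp: scalar_closed)
  ultimately show "(\<lambda>x\<in>E. a * f x) \<in> fspan \<FF> E S"
    using A(1,2) unfolding fspan_def
    by (intro CollectI exI[of _ A] exI[of _ "\<lambda>v. a * c v"]) simp
qed

lemma fspan_superset:
  assumes "S \<subseteq> extensional E"
  shows "S \<subseteq> fspan \<FF> E S"
proof
  fix f assume "f \<in> S"
  moreover have "f = lincomb E {f} (\<lambda>_. 1)"
    unfolding lincomb_def using assms \<open>f \<in> S\<close> by (auto simp: extensional_restrict)
  ultimately show "f \<in> fspan \<FF> E S"
    using scalar_closed unfolding fspan_def
    by (intro CollectI exI[of _ "{f}"] exI[of _ "\<lambda>_. 1"]) auto
qed

text \<open>
  Interpolation points are found one generator at a time. If the interpolation error \<open>g\<close> of the new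
  function \<open>f\<close> is not zero, it is nonzero at some point \<open>q\<close> of \<open>D\<close>, since \<open>D\<close> separates the functions of
  \<open>T\<close>. Then \<open>h = g / g(q)\<close> vanishes at the old points and serves as Lagrange function of \<open>q\<close>, and
  subtracting \<open>e\<^sub>p(q) h\<close> makes the old Lagrange functions vanish at \<open>q\<close>.
\<close>

lemma lagrange_functions:
  assumes T: "function_space \<FF> E T" and "D \<subseteq> E"
    and separated: "\<And>f. f \<in> T \<Longrightarrow> \<forall>x\<in>D. f x = 0 \<Longrightarrow> \<forall>x\<in>E. f x = 0"
    and "finite S" "S \<subseteq> T"
  shows "\<exists>P e. finite P \<and> P \<subseteq> D \<and> (\<forall>p\<in>P. e p \<in> T) \<and>
           (\<forall>p\<in>P. \<forall>q\<in>P. e p q = (if p = q then 1 else 0)) \<and>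
           (\<forall>f\<in>S. \<forall>x\<in>E. f x = (\<Sum>p\<in>P. f p * e p x))"
  using \<open>finite S\<close> \<open>S \<subseteq> T\<close>
proof (induction S)
  case empty
  show ?case by (intro exI[of _ "{}"]) simp
next
  case (insert f S)
  then have "S \<subseteq> T" by simp
  from insert.IH[OF this]
  obtain P e where lagrange: "finite P" "P \<subseteq> D" "\<forall>p\<in>P. e p \<in> T"
      "\<forall>p\<in>P. \<forall>q\<in>P. e p q = (if p = q then 1 else 0)"
      "\<forall>f\<in>S. \<forall>x\<in>E. f x = (\<Sum>p\<in>P. f p * e p x)"
    by (elim exE conjE)
  note P = lagrange(1,2) lagrange(3-5)[rule_format]
  have "f \<in> T" "P \<subseteq> E" using insert.prems P(2) \<open>D \<subseteq> E\<close> by auto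
  let ?i = "\<lambda>x\<in>E. \<Sum>p\<in>P. f p * e p x"
  let ?g = "\<lambda>x\<in>E. f x - ?i x"
  have "?i \<in> T"
    by (rule function_space_sum[OF T]) (use P(3) \<open>f \<in> T\<close> \<open>P \<subseteq> E\<close> function_space_value[OF T] in auto)
  then have g: "?g \<in> T"
    by (rule function_space_diff[OF T \<open>f \<in> T\<close>])
  show ?case
  proof (cases "\<forall>x\<in>D. ?g x = 0")
    case True
    then have "\<forall>x\<in>E. ?g x = 0" by (rule separated[OF g])
    then have "\<forall>x\<in>E. f x = (\<Sum>p\<in>P. f p * e p x)" by simp
    then show ?thesis
      using lagrange by (intro exI[of _ P] exI[of _ e]) blast
  next
    case False
    then obtain q where q: "q \<in> D" "?g q \<noteq> 0" by blast
    have "q \<in> E" using q \<open>D \<subseteq> E\<close> by auto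
    have g_P: "?g p = 0" if "p \<in> P" for p
    proof -
      have "(\<Sum>r\<in>P. f r * e r p) = (\<Sum>r\<in>P. if r = p then f r else 0)"
        by (rule sum.cong) (use P(4) that in auto)
      also have "\<dots> = f p" using P(1) that by simp
      finally show ?thesis using that \<open>P \<subseteq> E\<close> by auto
    qed
    then have "q \<notin> P" using q by blast
    define h where "h = (\<lambda>x\<in>E. inverse (?g q) * ?g x)"
    have "?g q \<in> \<FF>" using function_space_value[OF T g \<open>q \<in> E\<close>] .
    then have h_T: "h \<in> T"
      unfolding h_def by (intro function_space_scale[OF T] scalar_closed g)
    have h_q: "h q = 1" unfolding h_def using q(2) \<open>q \<in> E\<close> by simp
    have h_P: "h p = 0" if "p \<in> P" for p
      unfolding h_def using g_P[OF that] that \<open>P \<subseteq> E\<close> by (simp add: subset_eq)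
    define e' where "e' = (\<lambda>p. if p = q then h else (\<lambda>x\<in>E. e p x - (\<lambda>x\<in>E. e p q * h x) x))"
    have "e' p \<in> T" if "p \<in> insert q P" for p
      using that P(3) h_T function_space_value[OF T _ \<open>q \<in> E\<close>] unfolding e'_def
      by (auto simp del: restrict_apply intro!: function_space_diff[OF T] function_space_scale[OF T])
    moreover have "e' p r = (if p = r then 1 else 0)" if "p \<in> insert q P" "r \<in> insert q P" for p r
      using that h_q h_P P(4) \<open>q \<notin> P\<close> \<open>q \<in> E\<close> \<open>P \<subseteq> E\<close> unfolding e'_def by (auto simp: subset_eq)
    moreover have "k x = (\<Sum>p\<in>insert q P. k p * e' p x)" if k: "k \<in> insert f S" and x: "x \<in> E" for k x
    proof -
      \<comment> \<open>The error of interpolation at the old points is a multiple of \<open>h\<close>: it is zero for \<open>k \<in> S\<close> and \<open>g\<close> for \<open>k = f\<close>.\<close>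
      let ?r = "\<lambda>x. k x - (\<Sum>p\<in>P. k p * e p x)"
      have r: "?r x = ?r q * h x"
      proof (cases "k = f")
        case True
        then show ?thesis unfolding h_def using q(2) x \<open>q \<in> E\<close> by simp
      next
        case False
        then have "k \<in> S" using k by simp
        from P(5)[OF this x] P(5)[OF this \<open>q \<in> E\<close>] show ?thesis by simp
      qed
      have "(\<Sum>p\<in>insert q P. k p * e' p x) = k q * h x + (\<Sum>p\<in>P. k p * e' p x)"
        using P(1) \<open>q \<notin> P\<close> by (simp add: e'_def)
      also have "(\<Sum>p\<in>P. k p * e' p x) = (\<Sum>p\<in>P. k p * e p x - (k p * e p q) * h x)"
        by (rule sum.cong) (use x \<open>q \<notin> P\<close> in \<open>auto simp: e'_def algebra_simps\<close>)
      also have "\<dots> = (\<Sum>p\<in>P. k p * e p x) - (\<Sum>p\<in>P. k p * e p q) * h x"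
        by (simp add: sum_subtractf sum_distrib_right)
      finally have new: "(\<Sum>p\<in>insert q P. k p * e' p x) =
          k q * h x + ((\<Sum>p\<in>P. k p * e p x) - (\<Sum>p\<in>P. k p * e p q) * h x)" .
      show ?thesis unfolding new using r by (simp add: left_diff_distrib diff_eq_eq)
    qed
    ultimately show ?thesis
      using P(1,2) q(1) by (intro exI[of _ "insert q P"] exI[of _ e'] conjI ballI) auto
  qed
qed

end

text \<open>
  Bilinear rather than Hermitian, because \<open>\<integral> v d = v(a)\<close> contains no complex conjugation.
\<close>

definition pairing :: "(real ^ 'n) set \<Rightarrow> (real ^ 'n \<Rightarrow> complex) \<Rightarrow> (real ^ 'n \<Rightarrow> complex) \<Rightarrow> complex"
  where "pairing \<Omega> f g = integral\<^sup>L (lebesgue_on \<Omega>) (\<lambda>x. f x * g x)"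

lemma pairing_commute: "pairing \<Omega> f g = pairing \<Omega> g f"
  by (simp add: pairing_def mult.commute)

lemma pairing_cong: "(\<And>x. x \<in> \<Omega> \<Longrightarrow> f x = f' x) \<Longrightarrow> pairing \<Omega> f g = pairing \<Omega> f' g"
  unfolding pairing_def by (rule Bochner_Integration.integral_cong) auto

lemma integrable_product:
  assumes "f \<in> L2_continuous \<FF> \<Omega>" "g \<in> L2_continuous \<FF> \<Omega>"
  shows "integrable (lebesgue_on \<Omega>) (\<lambda>x. f x * g x)"
proof (rule Bochner_Integration.integrable_bound)
  show "integrable (lebesgue_on \<Omega>) (\<lambda>x. (norm (f x))\<^sup>2 + (norm (g x))\<^sup>2)"
    using assms by (auto simp: L2_continuous_def)
  show "(\<lambda>x. f x * g x) \<in> borel_measurable (lebesgue_on \<Omega>)"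
    using assms by (auto simp: L2_continuous_def)
  have "a * b \<le> a\<^sup>2 + b\<^sup>2" if "0 \<le> a" "0 \<le> b" for a b :: real
    using sum_squares_bound[of a b] mult_nonneg_nonneg[OF that] by linarith
  then show "AE x in lebesgue_on \<Omega>. norm (f x * g x) \<le> norm ((norm (f x))\<^sup>2 + (norm (g x))\<^sup>2)"
    by (simp add: norm_mult)
qed

lemma pairing_sum:
  assumes "\<And>p. p \<in> P \<Longrightarrow> d p \<in> L2_continuous \<FF> \<Omega>" "g \<in> L2_continuous \<FF> \<Omega>"
  shows "pairing \<Omega> (\<lambda>x\<in>closure \<Omega>. \<Sum>p\<in>P. c p * d p x) g = (\<Sum>p\<in>P. c p * pairing \<Omega> (d p) g)"
proof -
  have "pairing \<Omega> (\<lambda>x\<in>closure \<Omega>. \<Sum>p\<in>P. c p * d p x) g = pairing \<Omega> (\<lambda>x. \<Sum>p\<in>P. c p * d p x) g"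
    by (rule pairing_cong) (use closure_subset in auto)
  also have "\<dots> = integral\<^sup>L (lebesgue_on \<Omega>) (\<lambda>x. \<Sum>p\<in>P. c p * (d p x * g x))"
    unfolding pairing_def by (simp add: sum_distrib_right mult.assoc)
  also have "\<dots> = (\<Sum>p\<in>P. integral\<^sup>L (lebesgue_on \<Omega>) (\<lambda>x. c p * (d p x * g x)))"
    by (intro Bochner_Integration.integral_sum integrable_mult_right integrable_product[OF assms])
  finally show ?thesis by (simp add: pairing_def)
qed

lemma pairing_diff:
  assumes "f \<in> L2_continuous \<FF> \<Omega>" "f' \<in> L2_continuous \<FF> \<Omega>" "g \<in> L2_continuous \<FF> \<Omega>"
  shows "pairing \<Omega> (\<lambda>x\<in>closure \<Omega>. f x - f' x) g = pairing \<Omega> f g - pairing \<Omega> f' g"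
proof -
  have "pairing \<Omega> (\<lambda>x\<in>closure \<Omega>. f x - f' x) g = pairing \<Omega> (\<lambda>x. f x - f' x) g"
    by (rule pairing_cong) (use closure_subset in auto)
  also have "\<dots> = integral\<^sup>L (lebesgue_on \<Omega>) (\<lambda>x. f x * g x - f' x * g x)"
    unfolding pairing_def by (simp add: left_diff_distrib)
  also have "\<dots> = pairing \<Omega> f g - pairing \<Omega> f' g"
    unfolding pairing_def
    by (rule Bochner_Integration.integral_diff) (use assms integrable_product in auto)
  finally show ?thesis .
qed

definition delta_at :: "(real ^ 'n) set \<Rightarrow> (real ^ 'n \<Rightarrow> complex) set \<Rightarrow> real ^ 'n \<Rightarrow>
    (real ^ 'n \<Rightarrow> complex) \<Rightarrow> bool" where
  "delta_at \<Omega> T a d \<longleftrightarrow> d \<in> T \<and> (\<forall>v\<in>T. pairing \<Omega> v d = v a)"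

definition span_basis :: "complex set \<Rightarrow> 'a set \<Rightarrow> ('a \<Rightarrow> complex) set \<Rightarrow> ('a \<Rightarrow> complex) set \<Rightarrow> bool"
  where "span_basis \<FF> E T B \<longleftrightarrow>
    (\<forall>w\<in>T. \<exists>c\<in>B \<rightarrow> \<FF>. w = lincomb E B c) \<and>
    (\<forall>c. lincomb E B c = (\<lambda>x\<in>E. 0) \<longrightarrow> (\<forall>v\<in>B. c v = 0))"

context scalars
begin

text \<open>
  Coefficients of expansions are found by pairing, so for real spaces they have to be real.
\<close>

lemma pairing_scalar:
  assumes "f \<in> L2_continuous \<FF> \<Omega>" "g \<in> L2_continuous \<FF> \<Omega>"
  shows "pairing \<Omega> f g \<in> \<FF>"
proof (cases "\<FF> = UNIV")
  case False
  then have "\<FF> = \<real>" using real_or_complex by simp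
  then have "Im (f x * g x) = 0" if "x \<in> \<Omega>" for x
    using assms that closure_subset[of \<Omega>] unfolding L2_continuous_def
    by (auto simp: PiE_iff complex_is_Real_iff)
  then have "integral\<^sup>L (lebesgue_on \<Omega>) (\<lambda>x. Im (f x * g x)) = integral\<^sup>L (lebesgue_on \<Omega>) (\<lambda>_. 0)"
    by (intro Bochner_Integration.integral_cong) (simp_all del: times_complex.simps)
  then show ?thesis
    using integrable_product[OF assms] \<open>\<FF> = \<real>\<close>
    by (simp add: pairing_def complex_is_Real_iff del: times_complex.simps)
qed simp

lemma vanishing_on_closure:
  assumes "f \<in> L2_continuous \<FF> \<Omega>" "\<forall>x\<in>\<Omega>. f x = 0"
  shows "\<forall>x\<in>closure \<Omega>. f x = 0"
  using continuous_constant_on_closure[of \<Omega> f 0] assms by (auto simp: L2_continuous_def)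

text \<open>
  Pairing with the delta function at \<open>a\<close> evaluates at \<open>a\<close>, so a function orthogonal to \<open>T\<close> vanishes
  on \<open>\<Omega>\<close>.
\<close>

lemma pairing_nondegenerate:
  assumes L2: "T \<subseteq> L2_continuous \<FF> \<Omega>"
    and deltas: "\<And>a. a \<in> \<Omega> \<Longrightarrow> \<exists>d. delta_at \<Omega> T a d"
    and u: "u \<in> T" "\<And>v. v \<in> T \<Longrightarrow> pairing \<Omega> u v = 0"
  shows "\<forall>x\<in>closure \<Omega>. u x = 0"
proof (rule vanishing_on_closure)
  show "\<forall>a\<in>\<Omega>. u a = 0"
    using deltas u unfolding delta_at_def by metis
qed (use L2 u in auto)

lemma delta_at_unique:
  assumes T: "function_space \<FF> (closure \<Omega>) T" and L2: "T \<subseteq> L2_continuous \<FF> \<Omega>"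
    and deltas: "\<And>a. a \<in> \<Omega> \<Longrightarrow> \<exists>d. delta_at \<Omega> T a d"
    and d: "delta_at \<Omega> T a d" "delta_at \<Omega> T a d'"
  shows "d = d'"
proof -
  have dT: "d \<in> T" "d' \<in> T" using d by (auto simp: delta_at_def)
  let ?u = "\<lambda>x\<in>closure \<Omega>. d x - d' x"
  have "?u \<in> T" by (rule function_space_diff[OF T dT])
  moreover have "pairing \<Omega> ?u v = 0" if "v \<in> T" for v
    using d that dT L2 pairing_diff[of d \<FF> \<Omega> d' v]
    by (auto simp: delta_at_def pairing_commute[of _ _ v])
  ultimately have "\<forall>x\<in>closure \<Omega>. ?u x = 0"
    using pairing_nondegenerate[OF L2, of ?u] deltas by blast
  then show ?thesis
    using function_space_extensional[OF T] dT by (intro extensionalityI[of _ "closure \<Omega>"]) auto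
qed

text \<open>
  The delta functions at the interpolation points are the dual basis of the Lagrange functions; see
  the expansion \<open>w = \<Sum>\<^sub>p (\<integral> w e\<^sub>p) d\<^sub>p\<close> in the introduction.
\<close>

lemma delta_basis:
  assumes S: "finite S" "S \<subseteq> L2_continuous \<FF> \<Omega>"
    and L2: "fspan \<FF> (closure \<Omega>) S \<subseteq> L2_continuous \<FF> \<Omega>"
    and d: "\<And>a. a \<in> \<Omega> \<Longrightarrow> delta_at \<Omega> (fspan \<FF> (closure \<Omega>) S) a (d a)"
  shows "\<exists>P. finite P \<and> P \<subseteq> \<Omega> \<and> inj_on d P \<and>
           span_basis \<FF> (closure \<Omega>) (fspan \<FF> (closure \<Omega>) S) (d ` P)"
proof -
  let ?E = "closure \<Omega>"
  let ?T = "fspan \<FF> ?E S"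
  have SE: "S \<subseteq> ?E \<rightarrow>\<^sub>E \<FF>" using S(2) by (auto simp: L2_continuous_def)
  have T: "function_space \<FF> ?E ?T" by (rule function_space_fspan[OF SE])
  have ST: "S \<subseteq> ?T" by (rule fspan_superset) (use SE in \<open>auto simp: PiE_def\<close>)
  have dT: "d a \<in> ?T" if "a \<in> \<Omega>" for a using d[OF that] by (simp add: delta_at_def)
  have "\<exists>P e. finite P \<and> P \<subseteq> \<Omega> \<and> (\<forall>p\<in>P. e p \<in> ?T) \<and>
           (\<forall>p\<in>P. \<forall>q\<in>P. e p q = (if p = q then 1 else 0)) \<and>
           (\<forall>f\<in>S. \<forall>x\<in>?E. f x = (\<Sum>p\<in>P. f p * e p x))"
    by (rule lagrange_functions[OF T closure_subset _ S(1) ST])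
      (use vanishing_on_closure[OF subsetD[OF L2]] in blast)
  then obtain P e where lagrange: "finite P" "P \<subseteq> \<Omega>" "\<forall>p\<in>P. e p \<in> ?T"
      "\<forall>p\<in>P. \<forall>q\<in>P. e p q = (if p = q then 1 else 0)"
      "\<forall>f\<in>S. \<forall>x\<in>?E. f x = (\<Sum>p\<in>P. f p * e p x)"
    by (elim exE conjE)
  note P = lagrange(1,2) lagrange(3-5)[rule_format]
  have delta_pairing: "pairing \<Omega> (\<lambda>x\<in>?E. \<Sum>p\<in>P. c p * d p x) (e q) = c q" if "q \<in> P" for c q
  proof -
    have "pairing \<Omega> (\<lambda>x\<in>?E. \<Sum>p\<in>P. c p * d p x) (e q) = (\<Sum>p\<in>P. c p * pairing \<Omega> (d p) (e q))"
      by (rule pairing_sum[where \<FF> = \<FF>]) (use L2 dT P(2,3) that in blast)+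
    also have "\<dots> = (\<Sum>p\<in>P. if p = q then c p else 0)"
    proof (rule sum.cong)
      fix p assume "p \<in> P"
      then have "pairing \<Omega> (d p) (e q) = e q p"
        using d[of p] P(2) P(3)[OF that] by (auto simp: delta_at_def pairing_commute[of _ "d p"])
      then show "c p * pairing \<Omega> (d p) (e q) = (if p = q then c p else 0)"
        using P(4)[OF that \<open>p \<in> P\<close>] by auto
    qed simp
    finally show ?thesis using P(1) that by simp
  qed
  have indep: "c q = 0" if "(\<lambda>x\<in>?E. \<Sum>p\<in>P. c p * d p x) = (\<lambda>x\<in>?E. 0)" "q \<in> P" for c q
  proof -
    have "c q = pairing \<Omega> (\<lambda>x\<in>?E. 0) (e q)"
      using delta_pairing[OF that(2), of c] that(1) by simp
    also have "\<dots> = pairing \<Omega> (\<lambda>_. 0) (e q)"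
      by (rule pairing_cong) (use closure_subset in auto)
    finally show ?thesis by (simp add: pairing_def)
  qed
  have inj: "inj_on d P"
  proof (rule inj_onI, rule ccontr)
    fix p q assume pq: "p \<in> P" "q \<in> P" "d p = d q" "p \<noteq> q"
    \<comment> \<open>Equal delta functions at two points would be a linear relation with coefficients \<open>1\<close> and \<open>-1\<close>.\<close>
    let ?c = "\<lambda>r. (if r = p then 1 else 0) - (if r = q then 1 else 0) :: complex"
    have "(\<Sum>r\<in>P. ?c r * d r x) = (\<Sum>r\<in>P. if r = p then d r x else 0) - (\<Sum>r\<in>P. if r = q then d r x else 0)" for x
      unfolding sum_subtractf[symmetric] by (rule sum.cong) auto
    then have "(\<Sum>r\<in>P. ?c r * d r x) = 0" for x
      using pq P(1) by simp
    then have "?c p = 0"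
      by (intro indep) (simp_all add: pq)
    then show False using pq(4) by simp
  qed
  have lincomb_d: "lincomb ?E (d ` P) c = (\<lambda>x\<in>?E. \<Sum>p\<in>P. c (d p) * d p x)" for c
    unfolding lincomb_def by (simp add: sum.reindex[OF inj])
  have "\<exists>c\<in>d ` P \<rightarrow> \<FF>. w = lincomb ?E (d ` P) c" if w: "w \<in> ?T" for w
  proof -
    define c where "c p = pairing \<Omega> w (e p)" for p
    have c: "c p \<in> \<FF>" if "p \<in> P" for p
      unfolding c_def by (rule pairing_scalar) (use L2 w P(3) that in auto)
    let ?w = "\<lambda>x\<in>?E. \<Sum>p\<in>P. c p * d p x"
    \<comment> \<open>The error of the expansion is orthogonal to the Lagrange functions, hence to all of the space.\<close>
    define u where "u = (\<lambda>x\<in>?E. w x - ?w x)"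
    have w': "?w \<in> ?T"
      by (rule function_space_sum[OF T]) (use c dT P(2) in auto)
    have u: "u \<in> ?T" unfolding u_def by (rule function_space_diff[OF T w w'])
    have u_e: "pairing \<Omega> (e q) u = 0" if "q \<in> P" for q
    proof -
      have "pairing \<Omega> u (e q) = pairing \<Omega> w (e q) - pairing \<Omega> ?w (e q)"
        unfolding u_def by (rule pairing_diff[where \<FF> = \<FF>]) (use L2 w w' P(3) that in blast)+
      then show ?thesis using delta_pairing[OF that, of c] by (simp add: c_def pairing_commute)
    qed
    have u_S: "pairing \<Omega> f u = 0" if "f \<in> S" for f
    proof -
      have "pairing \<Omega> f u = pairing \<Omega> (\<lambda>x\<in>?E. \<Sum>p\<in>P. f p * e p x) u"
        by (rule pairing_cong) (use P(5)[OF that] closure_subset in auto)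
      also have "\<dots> = (\<Sum>p\<in>P. f p * pairing \<Omega> (e p) u)"
        by (rule pairing_sum[where \<FF> = \<FF>]) (use L2 P(3) u in blast)+
      finally show ?thesis using u_e by simp
    qed
    have "\<forall>x\<in>?E. u x = 0"
    proof (rule pairing_nondegenerate[OF L2 _ u])
      fix v assume "v \<in> ?T"
      then obtain A k where A: "A \<subseteq> S" "v = lincomb ?E A k" unfolding fspan_def by blast
      have "pairing \<Omega> v u = (\<Sum>f\<in>A. k f * pairing \<Omega> f u)"
        unfolding A(2) lincomb_def
        by (rule pairing_sum[where \<FF> = \<FF>]) (use L2 S(2) A(1) u in blast)+
      also have "\<dots> = 0"
        by (rule sum.neutral) (use u_S A(1) in auto)
      finally show "pairing \<Omega> u v = 0" by (simp add: pairing_commute)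
    qed (use d in blast)
    moreover have "w \<in> extensional ?E" using function_space_extensional[OF T] w by blast
    ultimately have "w = ?w"
      by (intro extensionalityI[of _ ?E]) (auto simp: u_def)
    also have "\<dots> = lincomb ?E (d ` P) (\<lambda>v. c (the_inv_into P d v))"
      unfolding lincomb_d by (auto simp: restrict_def the_inv_into_f_f[OF inj] intro!: sum.cong)
    finally show ?thesis
      using c by (intro bexI[of _ "\<lambda>v. c (the_inv_into P d v)"]) (auto simp: the_inv_into_f_f[OF inj])
  qed
  then have "span_basis \<FF> ?E ?T (d ` P)"
    unfolding span_basis_def lincomb_d using indep[of "\<lambda>p. _ (d p)"] by blast
  then show ?thesis using P(1,2) inj by blast
qed

end

section \<open>Ultrafunctions and their delta functions, level by level\<close>

context Lambda_limit
begin

lemma Lam_set_cfunI: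
  assumes "\<forall>\<^sub>F l in large. u l \<in> A l" "\<And>l. A l \<noteq> {}"
  shows "Lam_cfun Lam E u \<in> Lam_set (Lam_cfun Lam E) A"
proof -
  let ?v = "\<lambda>l. if u l \<in> A l then u l else (SOME v. v \<in> A l)"
  have "\<forall>l. ?v l \<in> A l"
    using assms(2) by (simp add: some_in_eq)
  moreover have "Lam_cfun Lam E u = Lam_cfun Lam E ?v"
    by (rule Lam_cfun_cong, rule eventually_mono[OF assms(1)]) simp
  ultimately show ?thesis
    unfolding Lam_set_def by blast
qed

end

locale ultrafunction_space = Lambda_limit atom coll Lam + scalars \<FF>
  for atom :: "real \<Rightarrow> 'u" and coll :: "'u set \<Rightarrow> 'u"
    and Lam :: "('u fset \<Rightarrow> real) \<Rightarrow> 'k :: {linordered_field, real_algebra_1}"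
    and \<FF> :: "complex set" +
  fixes \<Omega> :: "(real ^ 'n) set" and V :: "(real ^ 'n \<Rightarrow> complex) set"
  assumes V_space: "function_space \<FF> (closure \<Omega>) V"
    and V_L2: "V \<subseteq> L2_continuous \<FF> \<Omega>"
begin

abbreviation "T \<equiv> V_net atom coll \<FF> \<Omega> V"
abbreviation "W \<equiv> ultrafunctions atom coll Lam \<FF> \<Omega> V"
abbreviation "hlim \<equiv> Lam_cfun Lam (closure \<Omega>)"

lemma T_space: "function_space \<FF> (closure \<Omega>) (T l)"
  unfolding V_net_def by (rule function_space_fspan) (use V_space in \<open>auto simp: function_space_def\<close>)

lemma T_L2: "T l \<subseteq> L2_continuous \<FF> \<Omega>"
  unfolding V_net_def by (rule order_trans[OF fspan_subset[OF V_space] V_L2]) auto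

lemma T_extensional: "T l \<subseteq> extensional (closure \<Omega>)"
  by (rule function_space_extensional[OF T_space])

lemma zero_in_T: "(\<lambda>x\<in>closure \<Omega>. 0) \<in> T l"
  using T_space by (simp add: function_space_def)

lemma T_nonempty: "T l \<noteq> {}"
  using zero_in_T by blast

lemma W_iff: "w \<in> W \<longleftrightarrow> (\<exists>u. (\<forall>l. u l \<in> T l) \<and> w = hlim u)"
  unfolding ultrafunctions_def Lam_set_def by blast

lemma point_in_closure: "(\<And>l. x l \<in> \<Omega>) \<Longrightarrow> x l \<in> closure \<Omega>"
  using closure_subset by blast

lemma integral_star_product:
  assumes v: "\<And>l. v l \<in> T l" and d: "\<And>l. d l \<in> T l"
  shows "integral_star Lam \<Omega> (\<lambda>x\<in>nat_ext (Lam_point Lam) \<Omega>. hlim v x * hlim d x) =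
    Lam_complex Lam (\<lambda>l. pairing \<Omega> (v l) (d l))"
proof -
  let ?f = "\<lambda>l. \<lambda>x\<in>\<Omega>. v l x * d l x"
  have f_integral: "integral\<^sup>L (lebesgue_on \<Omega>) (?f l) = pairing \<Omega> (v l) (d l)" for l
    unfolding pairing_def by (rule Bochner_Integration.integral_cong) auto
  have f_L1: "?f l \<in> L1_functions \<Omega>" for l
  proof -
    have "integrable (lebesgue_on \<Omega>) (\<lambda>x. v l x * d l x)"
      by (rule integrable_product) (use v d T_L2 in blast)+
    then have "integrable (lebesgue_on \<Omega>) (?f l)"
      by (rule Bochner_Integration.integrable_cong[THEN iffD1, rotated 2]) auto
    then show ?thesis by (simp add: L1_functions_def)
  qed
  have "(\<lambda>x\<in>nat_ext (Lam_point Lam) \<Omega>. hlim v x * hlim d x) = Lam_cfun Lam \<Omega> ?f"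
  proof (rule extensionalityI[where A = "nat_ext (Lam_point Lam) \<Omega>"])
    fix a assume a: "a \<in> nat_ext (Lam_point Lam) \<Omega>"
    then obtain x where x: "\<forall>l. x l \<in> \<Omega>" "a = Lam_point Lam x"
      by (rule nat_ext_pointE)
    then have "hlim v a * hlim d a = Lam_complex Lam (\<lambda>l. v l (x l) * d l (x l))"
      using point_in_closure[of x] by (simp add: Lam_cfun_apply Lam_complex_mult)
    also have "\<dots> = Lam_cfun Lam \<Omega> ?f a"
      using x by (simp add: Lam_cfun_apply)
    finally show "(\<lambda>x\<in>nat_ext (Lam_point Lam) \<Omega>. hlim v x * hlim d x) a = Lam_cfun Lam \<Omega> ?f a"
      using a by simp
  qed (auto simp: Lam_fun_def)
  moreover have "integral_star Lam \<Omega> (Lam_cfun Lam \<Omega> ?f) =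
      Lam_complex Lam (\<lambda>l. integral\<^sup>L (lebesgue_on \<Omega>) (?f l))"
    unfolding integral_star_def
  proof (rule Lam_fun_apply[OF f_L1])
    fix g assume g: "\<And>l. g l \<in> L1_functions \<Omega>" "Lam_cfun Lam \<Omega> g = Lam_cfun Lam \<Omega> ?f"
    have "\<forall>\<^sub>F l in large. g l = ?f l"
      using g by (subst Lam_cfun_eq_iff[symmetric, where E = \<Omega>]) (auto simp: L1_functions_def PiE_def)
    then show "Lam_complex Lam (\<lambda>l. integral\<^sup>L (lebesgue_on \<Omega>) (g l)) =
        Lam_complex Lam (\<lambda>l. integral\<^sup>L (lebesgue_on \<Omega>) (?f l))"
      unfolding Lam_complex_eq_iff by (rule eventually_mono) simp
  qed
  ultimately show ?thesis by (simp add: f_integral)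
qed

text \<open>
  A net of functions \<open>v\<^sub>l \<in> V\<^sub>l\<close> violating the defining equation of the delta function on a large set
  of indices would have a limit that violates the one of the delta ultrafunction.
\<close>

lemma delta_ultrafunction_eventually:
  assumes x: "\<And>l. x l \<in> \<Omega>" and d: "\<And>l. d l \<in> T l"
    and delta: "delta_ultrafunction Lam \<Omega> W (Lam_point Lam x) (hlim d)"
  shows "\<forall>\<^sub>F l in large. delta_at \<Omega> (T l) (x l) (d l)"
proof -
  have "\<forall>\<^sub>F l in large. \<forall>v\<in>T l. pairing \<Omega> v (d l) = v (x l)"
  proof (rule eventually_ball_net[OF T_nonempty])
    fix v assume v: "\<And>l. v l \<in> T l"
    then have "hlim v \<in> W" by (auto simp: W_iff)
    then have "Lam_complex Lam (\<lambda>l. pairing \<Omega> (v l) (d l)) = hlim v (Lam_point Lam x)"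
      using delta by (simp add: delta_ultrafunction_def integral_star_product[OF v d, symmetric])
    also have "\<dots> = Lam_complex Lam (\<lambda>l. v l (x l))"
      by (rule Lam_cfun_apply) (rule point_in_closure[OF x])
    finally show "\<forall>\<^sub>F l in large. pairing \<Omega> (v l) (d l) = v l (x l)"
      by (simp add: Lam_complex_eq_iff)
  qed
  then show ?thesis
    by (rule eventually_mono) (simp add: delta_at_def d)
qed

text \<open>
  The first alternative arises because the net with all \<open>A\<^sub>l\<close> empty has an empty limit, whatever
  \<open>B\<close> is.
\<close>

lemma hyper_terms_eventually:
  assumes "hyper_terms Lam \<FF> (closure \<Omega>) (Lam_set hlim B) A c" "\<And>l. B l \<subseteq> extensional (closure \<Omega>)"
  shows "(\<forall>l. A l = {}) \<or> (\<forall>\<^sub>F l in large. A l \<subseteq> B l)"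
proof (cases "\<forall>l. A l = {}")
  case False
  then have "\<And>l. A l \<noteq> {}"
    using assms(1) unfolding hyper_terms_def finite_net_def by blast
  then have "\<forall>\<^sub>F l in large. A l \<subseteq> B l"
    using assms by (intro Lam_set_cfun_subsetD) (auto simp: hyper_terms_def PiE_def)
  then show ?thesis ..
qed simp

lemma hyper_span_subset: "hyper_span Lam \<FF> (closure \<Omega>) W \<subseteq> W"
proof
  fix w assume "w \<in> hyper_span Lam \<FF> (closure \<Omega>) W"
  then obtain A c where A: "hyper_terms Lam \<FF> (closure \<Omega>) W A c"
      and w: "w = hlim (\<lambda>l. lincomb (closure \<Omega>) (A l) (c l))"
    unfolding hyper_span_def hyper_lincomb_def by blast
  have "\<forall>\<^sub>F l in large. A l \<subseteq> T l"
    using hyper_terms_eventually[OF A[unfolded ultrafunctions_def] T_extensional] by auto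
  moreover have "c l \<in> A l \<rightarrow> \<FF>" for l
    using A by (simp add: hyper_terms_def)
  ultimately have "\<forall>\<^sub>F l in large. lincomb (closure \<Omega>) (A l) (c l) \<in> T l"
    using lincomb_in_function_space[OF T_space] by (auto elim: eventually_mono)
  then show "w \<in> W"
    unfolding w ultrafunctions_def by (rule Lam_set_cfunI[OF _ T_nonempty])
qed

lemma hyper_span_mono: "S \<subseteq> S' \<Longrightarrow> hyper_span Lam \<FF> E S \<subseteq> hyper_span Lam \<FF> E S'"
  unfolding hyper_span_def hyper_terms_def by blast

text \<open>
  Coordinates are computed at each index. A relation between elements of the limit of \<open>A\<close> lives, for a
  large set of indices, on subsets of \<open>A\<^sub>l\<close>, and extending its coefficients by zero gives a relation
  on the basis \<open>A\<^sub>l\<close>.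
\<close>

lemma hyper_basis_Lam_set:
  assumes net: "finite_net A" "\<And>l. A l \<subseteq> T l"
    and basis: "\<forall>\<^sub>F l in large. span_basis \<FF> (closure \<Omega>) (T l) (A l)"
  shows "hyper_basis Lam \<FF> (closure \<Omega>) W (Lam_set hlim A)"
proof -
  let ?E = "closure \<Omega>"
  have A_PiE: "A l \<subseteq> ?E \<rightarrow>\<^sub>E \<FF>" for l
    using T_space[of l] net(2)[of l] unfolding function_space_def by blast
  have A_W: "Lam_set hlim A \<subseteq> W"
    using net(2) unfolding ultrafunctions_def Lam_set_def by blast
  have "hyper_independent Lam \<FF> ?E (Lam_set hlim A)"
    unfolding hyper_independent_def
  proof (intro allI impI, elim conjE)
    fix A' c v
    assume A': "hyper_terms Lam \<FF> ?E (Lam_set hlim A) A' c"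
      and zero: "hyper_lincomb Lam ?E A' c = (\<lambda>\<xi>\<in>nat_ext (Lam_point Lam) ?E. 0)"
      and v: "\<forall>l. v l \<in> A' l"
    have "\<forall>\<^sub>F l in large. A' l \<subseteq> A l"
      using hyper_terms_eventually[OF A'] A_PiE v by (auto simp: PiE_def)
    moreover have "\<forall>\<^sub>F l in large. lincomb ?E (A' l) (c l) = (\<lambda>x\<in>?E. 0)"
      using zero unfolding hyper_lincomb_def Lam_cfun_zero[symmetric]
      by (subst Lam_cfun_eq_iff[symmetric, where E = ?E]) (auto simp: lincomb_def)
    ultimately have "\<forall>\<^sub>F l in large. c l (v l) = 0"
      using basis
    proof eventually_elim
      case (elim l)
      let ?c = "\<lambda>u. if u \<in> A' l then c l u else 0"
      have "finite (A l)" using net(1) by (simp add: finite_net_def)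
      then have "(\<Sum>u\<in>A' l. c l u * u x) = (\<Sum>u\<in>A l. ?c u * u x)" for x
        using elim(1) by (intro sum.mono_neutral_cong_left) auto
      then have "lincomb ?E (A l) ?c = (\<lambda>x\<in>?E. 0)"
        using elim(2) by (simp add: lincomb_def)
      then have "\<forall>u\<in>A l. ?c u = 0"
        using elim(3) unfolding span_basis_def by blast
      then show ?case using v elim(1) by fastforce
    qed
    then have "Lam_complex Lam (\<lambda>l. c l (v l)) = Lam_complex Lam (\<lambda>_. 0)"
      by (simp add: Lam_complex_eq_iff)
    then show "Lam_complex Lam (\<lambda>l. c l (v l)) = 0"
      by (simp add: Lam_complex_zero)
  qed
  moreover have "W \<subseteq> hyper_span Lam \<FF> ?E (Lam_set hlim A)"
  proof
    fix w assume "w \<in> W"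
    then obtain u where u: "\<And>l. u l \<in> T l" "w = hlim u" by (auto simp: W_iff)
    have "\<forall>l. \<exists>c\<in>A l \<rightarrow> \<FF>. span_basis \<FF> ?E (T l) (A l) \<longrightarrow> u l = lincomb ?E (A l) c"
    proof
      fix l
      have "(\<lambda>_. 0) \<in> A l \<rightarrow> \<FF>" using scalar_closed by auto
      then show "\<exists>c\<in>A l \<rightarrow> \<FF>. span_basis \<FF> ?E (T l) (A l) \<longrightarrow> u l = lincomb ?E (A l) c"
        using u(1)[of l] unfolding span_basis_def by blast
    qed
    then obtain c where c: "\<And>l. c l \<in> A l \<rightarrow> \<FF>"
        "\<And>l. span_basis \<FF> ?E (T l) (A l) \<longrightarrow> u l = lincomb ?E (A l) (c l)"
      by metis
    have "hyper_terms Lam \<FF> ?E (Lam_set hlim A) A c"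
      using net(1) A_PiE c(1) by (simp add: hyper_terms_def)
    moreover have "w = hyper_lincomb Lam ?E A c"
      unfolding u(2) hyper_lincomb_def
      by (rule Lam_cfun_cong, rule eventually_mono[OF basis]) (use c(2) in blast)
    ultimately show "w \<in> hyper_span Lam \<FF> ?E (Lam_set hlim A)"
      unfolding hyper_span_def by blast
  qed
  moreover have "hyper_span Lam \<FF> ?E (Lam_set hlim A) \<subseteq> W"
    using hyper_span_mono[OF A_W] hyper_span_subset by blast
  ultimately show ?thesis
    unfolding hyper_basis_def using net(1) A_PiE A_W by blast
qed

end

locale delta_system = ultrafunction_space atom coll Lam \<FF> \<Omega> V
  for atom :: "real \<Rightarrow> 'u" and coll :: "'u set \<Rightarrow> 'u"
    and Lam :: "('u fset \<Rightarrow> real) \<Rightarrow> 'k :: {linordered_field, real_algebra_1}"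
    and \<FF> :: "complex set" and \<Omega> :: "(real ^ 'n) set" and V :: "(real ^ 'n \<Rightarrow> complex) set" +
  fixes \<delta> :: "'k ^ 'n \<Rightarrow> ('k ^ 'n \<Rightarrow> 'k hcomplex)"
  assumes delta: "a \<in> nat_ext (Lam_point Lam) \<Omega> \<Longrightarrow>
    delta_ultrafunction Lam \<Omega> (ultrafunctions atom coll Lam \<FF> \<Omega> V) a (\<delta> a)"
begin

definition has_deltas :: "'u fset \<Rightarrow> bool" where
  "has_deltas l \<longleftrightarrow> (\<forall>a\<in>\<Omega>. \<exists>d. delta_at \<Omega> (T l) a d)"

text \<open>
  The value zero in the remaining cases keeps \<open>level_delta l a\<close> inside \<open>V\<^sub>l\<close> for every \<open>l\<close>, as is needed to
  form nets.
\<close>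

definition level_delta :: "'u fset \<Rightarrow> real ^ 'n \<Rightarrow> real ^ 'n \<Rightarrow> complex" where
  "level_delta l a =
     (if \<exists>d. delta_at \<Omega> (T l) a d then SOME d. delta_at \<Omega> (T l) a d else (\<lambda>x\<in>closure \<Omega>. 0))"

lemma level_delta: "has_deltas l \<Longrightarrow> a \<in> \<Omega> \<Longrightarrow> delta_at \<Omega> (T l) a (level_delta l a)"
  unfolding level_delta_def has_deltas_def by (simp add: someI_ex)

lemma level_delta_in_T: "level_delta l a \<in> T l"
proof (cases "\<exists>d. delta_at \<Omega> (T l) a d")
  case True
  then have "delta_at \<Omega> (T l) a (level_delta l a)"
    unfolding level_delta_def by (simp add: someI_ex)
  then show ?thesis by (simp add: delta_at_def)
next
  case False
  then have "level_delta l a = (\<lambda>x\<in>closure \<Omega>. 0)"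
    by (simp add: level_delta_def)
  then show ?thesis using zero_in_T by metis
qed

lemma net_delta:
  assumes x: "\<And>l. x l \<in> \<Omega>"
  obtains d where "\<And>l. d l \<in> T l" "\<delta> (Lam_point Lam x) = hlim d"
    "\<forall>\<^sub>F l in large. delta_at \<Omega> (T l) (x l) (d l)"
proof -
  have "Lam_point Lam x \<in> nat_ext (Lam_point Lam) \<Omega>"
    using x unfolding nat_ext_def Lam_set_def by blast
  note \<delta>_x = delta[OF this]
  then obtain d where d: "\<And>l. d l \<in> T l" "\<delta> (Lam_point Lam x) = hlim d"
    by (auto simp: delta_ultrafunction_def W_iff)
  then show thesis
    using delta_ultrafunction_eventually[of x d, OF x d(1)] \<delta>_x that[of d] by simp
qed

text \<open>
  A net of points without delta functions would have a limit at which \<open>\<delta>\<close> is not a delta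
  ultrafunction.
\<close>

lemma eventually_has_deltas: "\<forall>\<^sub>F l in large. has_deltas l"
proof (cases "\<Omega> = {}")
  case False
  then have "\<forall>\<^sub>F l in large. \<forall>a\<in>\<Omega>. \<exists>d. delta_at \<Omega> (T l) a d"
  proof (intro eventually_ball_net)
    fix x :: "'u fset \<Rightarrow> real ^ 'n" assume "\<And>l. x l \<in> \<Omega>"
    then obtain d where "\<forall>\<^sub>F l in large. delta_at \<Omega> (T l) (x l) (d l)"
      by (rule net_delta)
    then show "\<forall>\<^sub>F l in large. \<exists>d. delta_at \<Omega> (T l) (x l) d"
      by (rule eventually_mono) blast
  qed
  then show ?thesis by (simp add: has_deltas_def)
next
  case True
  then have "has_deltas l" for l unfolding has_deltas_def by blast
  then show ?thesis by simp
qed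

text \<open>
  The given \<open>\<delta>\<close> is the limit of some net of functions about which nothing is known at single indices;
  uniqueness of delta functions identifies that net with \<open>level_delta\<close> on a large set.
\<close>

lemma delta_net:
  assumes x: "\<And>l. x l \<in> \<Omega>"
  shows "\<delta> (Lam_point Lam x) = hlim (\<lambda>l. level_delta l (x l))"
proof -
  obtain d where d: "\<delta> (Lam_point Lam x) = hlim d" "\<forall>\<^sub>F l in large. delta_at \<Omega> (T l) (x l) (d l)"
    by (rule net_delta[OF x])
  have "\<forall>\<^sub>F l in large. d l = level_delta l (x l)"
    using d(2) eventually_has_deltas
  proof eventually_elim
    case (elim l)
    show ?case
      by (rule delta_at_unique[OF T_space T_L2 _ elim(1) level_delta[OF elim(2) x]])
        (use elim(2) in \<open>auto simp: has_deltas_def\<close>)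
  qed
  then show ?thesis
    unfolding d(1) by (rule Lam_cfun_cong)
qed

definition basis_points :: "'u fset \<Rightarrow> (real ^ 'n) set \<Rightarrow> bool" where
  "basis_points l P \<longleftrightarrow> finite P \<and> P \<subseteq> \<Omega> \<and> inj_on (level_delta l) P \<and>
     span_basis \<FF> (closure \<Omega>) (T l) (level_delta l ` P)"

lemma basis_points_exist:
  assumes "has_deltas l"
  shows "\<exists>P. basis_points l P"
  unfolding basis_points_def V_net_def
proof (rule delta_basis)
  show "finite {f \<in> V. graph_code atom coll (closure \<Omega>) f |\<in>| l}"
    by (rule finite_coded_functions) (rule function_space_extensional[OF V_space])
qed (use V_L2 T_L2[of l] level_delta[OF assms] in \<open>auto simp: V_net_def\<close>)

text \<open>
  A hyperfinite sum needs point sets that are all empty or all nonempty. As \<open>large\<close> is an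
  ultrafilter, one of the two alternatives holds on a large set of indices; on the others the point
  set may be changed freely, to \<open>{}\<close> or to a singleton.
\<close>

lemma basis_points_net:
  obtains P where "\<forall>l. finite (P l)" "\<forall>l. P l \<subseteq> \<Omega>" "(\<forall>l. P l \<noteq> {}) \<or> (\<forall>l. P l = {})"
    "\<forall>\<^sub>F l in large. basis_points l (P l)"
proof -
  have ev: "\<forall>\<^sub>F l in large. \<exists>P. basis_points l P"
    using eventually_has_deltas by (rule eventually_mono) (rule basis_points_exist)
  show thesis
  proof (cases "\<forall>\<^sub>F l in large. basis_points l {}")
    case True
    then show thesis by (intro that[of "\<lambda>_. {}"]) auto
  next
    case False
    then have "\<forall>\<^sub>F l in large. \<not> basis_points l {}"
      using large_ultra[of "\<lambda>l. basis_points l {}"] by blast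
    with ev have ev': "\<forall>\<^sub>F l in large. \<exists>P. P \<noteq> {} \<and> basis_points l P"
      by eventually_elim metis
    have "\<Omega> \<noteq> {}"
    proof
      assume "\<Omega> = {}"
      then have empty: "P = {}" if "basis_points l P" for l P
        using that unfolding basis_points_def by blast
      from ev have "\<forall>\<^sub>F l in large. basis_points l {}"
        by (rule eventually_mono) (use empty in blast)
      with False show False by blast
    qed
    then obtain x\<^sub>0 where "x\<^sub>0 \<in> \<Omega>" by blast
    define P where "P l = (if \<exists>P. P \<noteq> {} \<and> basis_points l P
      then SOME P. P \<noteq> {} \<and> basis_points l P else {x\<^sub>0})" for l
    have P: "P l \<noteq> {} \<and> basis_points l (P l)" if "\<exists>P. P \<noteq> {} \<and> basis_points l P" for l
      unfolding P_def using someI_ex[OF that] that by simp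
    have P': "finite (P l) \<and> P l \<subseteq> \<Omega> \<and> P l \<noteq> {}" for l
    proof (cases "\<exists>P. P \<noteq> {} \<and> basis_points l P")
      case True
      from P[OF this] show ?thesis by (simp add: basis_points_def)
    next
      case False
      show ?thesis unfolding P_def if_not_P[OF False] using \<open>x\<^sub>0 \<in> \<Omega>\<close> by simp
    qed
    have "\<forall>\<^sub>F l in large. basis_points l (P l)"
      using ev' by (rule eventually_mono) (rule P[THEN conjunct2])
    with P' show thesis
      by (intro that[of P]) simp_all
  qed
qed

theorem delta_basis_exists:
  "\<exists>\<Sigma> \<subseteq> nat_ext (Lam_point Lam) \<Omega>. inj_on \<delta> \<Sigma> \<and> hyper_basis Lam \<FF> (closure \<Omega>) W (\<delta> ` \<Sigma>)"
proof -
  obtain P where P: "\<forall>l. finite (P l)" "\<forall>l. P l \<subseteq> \<Omega>" "(\<forall>l. P l \<noteq> {}) \<or> (\<forall>l. P l = {})"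
      "\<forall>\<^sub>F l in large. basis_points l (P l)"
    by (rule basis_points_net)
  let ?A = "\<lambda>l. level_delta l ` P l"
  let ?\<Sigma> = "Lam_set (Lam_point Lam) P"
  have \<delta>_\<Sigma>: "\<delta> (Lam_point Lam x) = hlim (\<lambda>l. level_delta l (x l))" if "\<forall>l. x l \<in> P l" for x
    using that P(2) by (intro delta_net) blast
  have image: "\<delta> ` ?\<Sigma> = Lam_set hlim ?A"
  proof (intro equalityI subsetI)
    fix d assume "d \<in> \<delta> ` ?\<Sigma>"
    then obtain x where "\<forall>l. x l \<in> P l" "d = \<delta> (Lam_point Lam x)"
      unfolding Lam_set_def by blast
    then show "d \<in> Lam_set hlim ?A"
      using \<delta>_\<Sigma> unfolding Lam_set_def by blast
  next
    fix d assume "d \<in> Lam_set hlim ?A"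
    then obtain u where u: "\<forall>l. u l \<in> ?A l" "d = hlim u"
      unfolding Lam_set_def by blast
    then obtain x where x: "\<forall>l. x l \<in> P l" "\<forall>l. u l = level_delta l (x l)"
      unfolding image_iff Bex_def by metis
    then have "u = (\<lambda>l. level_delta l (x l))" by auto
    then have "d = \<delta> (Lam_point Lam x)"
      using \<delta>_\<Sigma>[OF x(1)] u(2) by simp
    then show "d \<in> \<delta> ` ?\<Sigma>"
      using x(1) unfolding Lam_set_def by blast
  qed
  have "inj_on \<delta> ?\<Sigma>"
  proof (rule inj_onI)
    fix a b assume "a \<in> ?\<Sigma>" "b \<in> ?\<Sigma>" and eq: "\<delta> a = \<delta> b"
    then obtain x y where x: "\<forall>l. x l \<in> P l" "a = Lam_point Lam x"
        and y: "\<forall>l. y l \<in> P l" "b = Lam_point Lam y"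
      unfolding Lam_set_def by blast
    have "hlim (\<lambda>l. level_delta l (x l)) = hlim (\<lambda>l. level_delta l (y l))"
      using eq \<delta>_\<Sigma>[OF x(1)] \<delta>_\<Sigma>[OF y(1)] x(2) y(2) by simp
    moreover have "level_delta l p \<in> extensional (closure \<Omega>)" for l p
      using T_extensional level_delta_in_T by blast
    ultimately have "\<forall>\<^sub>F l in large. level_delta l (x l) = level_delta l (y l)"
      by (simp add: Lam_cfun_eq_iff)
    with P(4) have "\<forall>\<^sub>F l in large. x l = y l"
      by eventually_elim (use x(1) y(1) in \<open>auto simp: basis_points_def dest: inj_onD\<close>)
    then show "a = b"
      unfolding x(2) y(2) by (simp add: Lam_point_eq_iff)
  qed
  moreover have "?\<Sigma> \<subseteq> nat_ext (Lam_point Lam) \<Omega>"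
    using P(2) unfolding nat_ext_def Lam_set_def by blast
  moreover have "hyper_basis Lam \<FF> (closure \<Omega>) W (\<delta> ` ?\<Sigma>)"
    unfolding image
  proof (rule hyper_basis_Lam_set)
    show "finite_net ?A" using P(1,3) by (auto simp: finite_net_def)
    show "\<forall>\<^sub>F l in large. span_basis \<FF> (closure \<Omega>) (T l) (?A l)"
      using P(4) by (rule eventually_mono) (simp add: basis_points_def)
  qed (use level_delta_in_T in blast)
  ultimately show ?thesis by blast
qed

lemma deltas_generate: "hyper_span Lam \<FF> (closure \<Omega>) (\<delta> ` nat_ext (Lam_point Lam) \<Omega>) = W"
proof (rule antisym)
  have "\<delta> ` nat_ext (Lam_point Lam) \<Omega> \<subseteq> W"
  proof (rule image_subsetI)
    fix a assume "a \<in> nat_ext (Lam_point Lam) \<Omega>"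
    from delta[OF this] show "\<delta> a \<in> W"
      by (simp add: delta_ultrafunction_def)
  qed
  then show "hyper_span Lam \<FF> (closure \<Omega>) (\<delta> ` nat_ext (Lam_point Lam) \<Omega>) \<subseteq> W"
    by (rule order_trans[OF hyper_span_mono hyper_span_subset])
  obtain \<Sigma> where \<Sigma>: "\<Sigma> \<subseteq> nat_ext (Lam_point Lam) \<Omega>"
      "hyper_basis Lam \<FF> (closure \<Omega>) W (\<delta> ` \<Sigma>)"
    using delta_basis_exists by blast
  from \<Sigma>(2) have "hyper_span Lam \<FF> (closure \<Omega>) (\<delta> ` \<Sigma>) = W"
    by (simp add: hyper_basis_def)
  with hyper_span_mono[OF image_mono[OF \<Sigma>(1)]]
  show "W \<subseteq> hyper_span Lam \<FF> (closure \<Omega>) (\<delta> ` nat_ext (Lam_point Lam) \<Omega>)"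
    by metis
qed

end

theorem mainTheorem2:
  fixes atom :: "real \<Rightarrow> 'u" and coll :: "'u set \<Rightarrow> 'u"
    and Lam :: "('u fset \<Rightarrow> real) \<Rightarrow> 'k :: {linordered_field, real_algebra_1}"
    and \<FF> :: "complex set"
    and \<Omega> :: "(real ^ 'n) set"
    and V :: "(real ^ 'n \<Rightarrow> complex) set"
    and \<delta> :: "'k ^ 'n \<Rightarrow> ('k ^ 'n \<Rightarrow> 'k hcomplex)"
  assumes "Lambda_limit atom coll Lam"
    and "\<FF> = \<real> \<or> \<FF> = UNIV"
    and "function_space \<FF> (closure \<Omega>) V"
    and "test_functions \<FF> \<Omega> \<subseteq> V"
    and "V \<subseteq> L2_continuous \<FF> \<Omega>"
    and "\<And>a. a \<in> nat_ext (Lam_point Lam) \<Omega> \<Longrightarrow>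
           delta_ultrafunction Lam \<Omega> (ultrafunctions atom coll Lam \<FF> \<Omega> V) a (\<delta> a)"
  shows "hyper_span Lam \<FF> (closure \<Omega>) (\<delta> ` nat_ext (Lam_point Lam) \<Omega>) =
           ultrafunctions atom coll Lam \<FF> \<Omega> V \<and>
         (\<exists>\<Sigma> \<subseteq> nat_ext (Lam_point Lam) \<Omega>. inj_on \<delta> \<Sigma> \<and>
           hyper_basis Lam \<FF> (closure \<Omega>) (ultrafunctions atom coll Lam \<FF> \<Omega> V) (\<delta> ` \<Sigma>))"
proof -
  interpret delta_system atom coll Lam \<FF> \<Omega> V \<delta>
    by (intro delta_system.intro ultrafunction_space.intro scalars.intro
        ultrafunction_space_axioms.intro delta_system_axioms.intro assms)
  show ?thesis
    using deltas_generate delta_basis_exists by blast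
qed

end
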